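(* Let $n\ge 1$, let $\alpha\in\mathcal{T}_n$ be an idempotent of rank $l$, and consider the variant $(\mathcal{T}_n,* )$ with $\beta*\gamma=\beta\alpha\gamma$. Then every isolated subsemigroup $T$ of $(\mathcal{T}_n,* )$ is one of the following: (i) $F(X,Y)$ with $\varnothing\ne X\subseteq\mathcal{X}$ and $\varnothing\neq Y\subseteq\mathcal{Y}$; (ii) if $l>1$: $H(k,m,X,Y)$ with $k,m\in\{1,\dots,l\}$, $k\ne m$, $\varnothing\ne X\subseteq\mathcal{U}^{(k,m)}$ and $\varnothing\ne Y\subseteq\mathcal{V}^{(k)}$; (iii) if $l>1$: $K(\{k,m\},X)$ with $\{k,m\}\subseteq\{1,\dots,l\}$, $k\ne m$, and $\varnothing\ne X\subseteq\mathcal{U}^{(k,m)}$; (iv) if $l>1$: $L(k,M,Y)$ with $k\in\{1,\dots,l\}$, $\varnothing\ne Y\subseteq\mathcal{V}^{(k)}$, and $M\subseteq\{a_1,\dots,a_{k-1},a_{k+1},\dots,a_l\}$ with $|M|>1$; (v) if $l>2$: $\mathcal{T}_n\setminus\mathcal{T}_n^{(l)}$; (vi) if $l>1$: $F(X,Y)\cup(\mathcal{T}_n\setminus\mathcal{T}_n^{(l)})$ with $\varnothing\ne X\subseteq\mathcal{X}$ and $\varnothing\neq Y\subseteq\mathcal{Y}$. All semigroups in this list (for different items or different choices of parameters) are pairwise different, and the list is a complete classification of the isolated subsemigroups of $(\mathcal{T}_n,* )$ (i.e. each listed set is an isolated subsemigroup, and there are no others).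
   Context: Subsemigroups are non-empty. A subsemigroup $T$ of a semigroup $S$ is isolated if for all $x\in S$: $x^j\in T$ for some $j>0$ implies $x\in T$. $N=\{1,\dots,n\}$; $\mathcal{T}_n$ is the set of all maps $N\to N$, composed from left to right: $(\beta\gamma)(x)=\gamma(\beta(x))$. $\operatorname{im}(\beta)$ is the image of $\beta$, $\operatorname{rank}(\beta)=|\operatorname{im}(\beta)|$, and $\Lambda_\beta$ is the kernel of $\beta$: the equivalence relation (partition of $N$) $x\,\Lambda_\beta\, y\iff\beta(x)=\beta(y)$. $\alpha\in\mathcal{T}_n$ is an idempotent ($\alpha\alpha=\alpha$) of rank $l$ with kernel blocks $A_1,\dots,A_l$ and image $A=\{a_1,\dots,a_l\}$, where $\alpha(A_i)=\{a_i\}$, so $a_i\in A_i$. The variant $(\mathcal{T}_n,* )$ has operation $\beta*\gamma=\beta\alpha\gamma$; all idempotents and powers are taken with respect to $*$. For an idempotent $\varepsilon$ of $(\mathcal{T}_n,* )$, $\sqrt{\varepsilon}$ is the set of all $\beta$ some $*$-power of which equals $\varepsilon$. For $\beta\in\mathcal{T}_n$ let $\varepsilon$ be the unique idempotent in the cyclic subsemigroup of $(\mathcal{T}_n,* )$ generated by $\beta$; the stable rank of $\beta$ is $\operatorname{rank}(\varepsilon)$. It is at most $l$. $\mathcal{T}_n^{(i)}$ is the set of elements of stable rank $i$. $\mathcal{X}$ is the set of all partitions of $N$ into $l$ blocks such that $a_1,\dots,a_l$ lie in different blocks. $\mathcal{Y}$ is the set of all sets $\{b_1,\dots,b_l\}$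 with $b_i\in A_i$ for all $i$. $F(X,Y)$ is the union of all $\sqrt{\varepsilon}$ where $\varepsilon$ is an idempotent of $(\mathcal{T}_n,* )$ of rank $l$ with $\Lambda_\varepsilon\in X$ and $\operatorname{im}(\varepsilon)\in Y$. Let $l\ge2$ and let $\varepsilon$ be an idempotent of $(\mathcal{T}_n,* )$ of rank $l-1$. Then the elements of $\operatorname{im}(\varepsilon)$ lie in pairwise different blocks $A_i$, and there is a unique pair $\{a_m,a_k\}$, $m\neq k$, of elements of $A$ contained in a common block of $\Lambda_\varepsilon$, labelled so that $\varepsilon(a_m)=\varepsilon(a_k)\in A_m$ (then $A_k\cap\operatorname{im}(\varepsilon)=\varnothing$). Put $\mathfrak{t}(\varepsilon)=a_k$ (trifle element), $\mathfrak{b}(\varepsilon)=a_m$ (burdened element), and for $\beta\in\sqrt{\varepsilon}$ put $\mathfrak{t}(\beta)=\mathfrak{t}(\varepsilon)$, $\mathfrak{b}(\beta)=\mathfrak{b}(\varepsilon)$. $\mathcal{T}_n^{(l-1,k)}$ is the set of $\beta\in\mathcal{T}_n^{(l-1)}$ with $\mathfrak{t}(\beta)=a_k$, and $\mathcal{T}_n^{(l-1,k,m)}$ is the set of $\beta\in\mathcal{T}_n^{(l-1,k)}$ with $\mathfrak{b}(\beta)=a_m$. For $k\ne m$, $\mathcal{U}^{(k,m)}=\mathcal{U}^{(m,k)}$ is the set of all partitions of $N$ into $l-1$ blocks such that every block contains at least one element of $A$ and $a_k,a_m$ lie in the same block. $\mathcal{V}^{(k)}$ is the set of all sets $\{b_i: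 i\in\{1,\dots,l\},\,i\ne k\}$ with $b_i\in A_i$. Then: - $H(k,m,X,Y)$ is the union of all $\sqrt{\varepsilon}$ with $\varepsilon\in\mathcal{T}_n^{(l-1,k,m)}$ an idempotent, $\Lambda_\varepsilon\in X$, $\operatorname{im}(\varepsilon)\in Y$; - $K(\{k,m\},X)$ is the union of all $\sqrt{\varepsilon}$ with $\varepsilon\in\mathcal{T}_n^{(l-1,k,m)}\cup\mathcal{T}_n^{(l-1,m,k)}$ an idempotent, $\Lambda_\varepsilon\in X$; - $L(k,M,Y)$ is the union of all $\sqrt{\varepsilon}$ with $\varepsilon\in\mathcal{T}_n^{(l-1,k)}$ an idempotent, $\mathfrak{b}(\varepsilon)\in M$, $\operatorname{im}(\varepsilon)\in Y$. *)

theory Defs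
  imports Main "HOL-Library.Disjoint_Sets"
begin

section \<open>Isolated subsemigroups\<close>

text \<open>A binary operation is passed explicitly, because one set of maps carries many products.\<close>

definition subsemigroup :: "('a \<Rightarrow> 'a \<Rightarrow> 'a) \<Rightarrow> 'a set \<Rightarrow> bool" where
  "subsemigroup f T \<longleftrightarrow> T \<noteq> {} \<and> (\<forall>x\<in>T. \<forall>y\<in>T. f x y \<in> T)"

text \<open>The power \<open>x\<^sup>j\<close>; it is meaningful for \<open>j > 0\<close> only, since there need not be a unit.\<close>

definition sg_power :: "('a \<Rightarrow> 'a \<Rightarrow> 'a) \<Rightarrow> 'a \<Rightarrow> nat \<Rightarrow> 'a" where
  "sg_power f x j = ((\<lambda>y. f y x) ^^ (j - 1)) x"

definition isolated_subsemigroup :: "('a \<Rightarrow> 'a \<Rightarrow> 'a) \<Rightarrow> 'a set \<Rightarrow> bool" where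
  "isolated_subsemigroup f T \<longleftrightarrow>
     subsemigroup f T \<and> (\<forall>x. (\<exists>j>0. sg_power f x j \<in> T) \<longrightarrow> x \<in> T)"

definition idem :: "('a \<Rightarrow> 'a \<Rightarrow> 'a) \<Rightarrow> 'a \<Rightarrow> bool" where
  "idem f e \<longleftrightarrow> f e e = e"

definition root_set :: "('a \<Rightarrow> 'a \<Rightarrow> 'a) \<Rightarrow> 'a \<Rightarrow> 'a set" where
  "root_set f e = {x. \<exists>j>0. sg_power f x j = e}"

definition cyclic_subsemigroup :: "('a \<Rightarrow> 'a \<Rightarrow> 'a) \<Rightarrow> 'a \<Rightarrow> 'a set" where
  "cyclic_subsemigroup f x = {sg_power f x j | j. j > 0}"

definition cyclic_idem :: "('a \<Rightarrow> 'a \<Rightarrow> 'a) \<Rightarrow> 'a \<Rightarrow> 'a" where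
  "cyclic_idem f x = (THE e. e \<in> cyclic_subsemigroup f x \<and> idem f e)"

section \<open>The variant of the full transformation semigroup\<close>

text \<open>
  The set \<open>{1, \<dots>, n}\<close> is rendered by a finite type \<open>'n\<close>, so \<open>'n \<Rightarrow> 'n\<close> is the whole full
  transformation semigroup and \<open>CARD('n) \<ge> 1\<close> holds automatically.
  Maps are composed from left to right, so the product \<open>\<beta>\<alpha>\<gamma>\<close> sends \<open>x\<close> to \<open>\<gamma> (\<alpha> (\<beta> x))\<close>.
\<close>

definition variant :: "('n \<Rightarrow> 'n) \<Rightarrow> ('n \<Rightarrow> 'n) \<Rightarrow> ('n \<Rightarrow> 'n) \<Rightarrow> ('n \<Rightarrow> 'n)" where
  "variant \<alpha> \<beta> \<gamma> = \<gamma> \<circ> \<alpha> \<circ> \<beta>"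

definition map_rank :: "('n \<Rightarrow> 'n) \<Rightarrow> nat" where
  "map_rank \<beta> = card (range \<beta>)"

text \<open>The kernel equivalence relation, given by its partition into classes.\<close>

definition map_kernel :: "('n \<Rightarrow> 'n) \<Rightarrow> 'n set set" where
  "map_kernel \<beta> = UNIV // {(x, y). \<beta> x = \<beta> y}"

definition stable_rank :: "('n \<Rightarrow> 'n) \<Rightarrow> ('n \<Rightarrow> 'n) \<Rightarrow> nat" where
  "stable_rank \<alpha> \<beta> = map_rank (cyclic_idem (variant \<alpha>) \<beta>)"

definition stable_layer :: "('n \<Rightarrow> 'n) \<Rightarrow> nat \<Rightarrow> ('n \<Rightarrow> 'n) set" where
  "stable_layer \<alpha> i = {\<beta>. stable_rank \<alpha> \<beta> = i}"

text \<open>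
  Below, \<open>l = map_rank \<alpha>\<close>, and \<open>a 1, \<dots>, a l\<close> is an enumeration of the image of the
  idempotent \<open>\<alpha>\<close>; the block \<open>A\<^sub>i\<close> is the fibre of \<open>\<alpha>\<close> over \<open>a i\<close>.
\<close>

definition block :: "('n \<Rightarrow> 'n) \<Rightarrow> (nat \<Rightarrow> 'n) \<Rightarrow> nat \<Rightarrow> 'n set" where
  "block \<alpha> a i = \<alpha> -` {a i}"

definition X_all :: "('n \<Rightarrow> 'n) \<Rightarrow> (nat \<Rightarrow> 'n) \<Rightarrow> 'n set set set" where
  "X_all \<alpha> a = {P. partition_on UNIV P \<and> card P = map_rank \<alpha> \<and>
     (\<forall>B\<in>P. \<forall>i\<in>{1..map_rank \<alpha>}. \<forall>j\<in>{1..map_rank \<alpha>}. a i \<in> B \<and> a j \<in> B \<longrightarrow> i = j)}"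

definition Y_all :: "('n \<Rightarrow> 'n) \<Rightarrow> (nat \<Rightarrow> 'n) \<Rightarrow> 'n set set" where
  "Y_all \<alpha> a = {b ` {1..map_rank \<alpha>} | b. \<forall>i\<in>{1..map_rank \<alpha>}. b i \<in> block \<alpha> a i}"

definition F_set :: "('n \<Rightarrow> 'n) \<Rightarrow> 'n set set set \<Rightarrow> 'n set set \<Rightarrow> ('n \<Rightarrow> 'n) set" where
  "F_set \<alpha> X Y = \<Union> {root_set (variant \<alpha>) \<epsilon> | \<epsilon>.
     idem (variant \<alpha>) \<epsilon> \<and> map_rank \<epsilon> = map_rank \<alpha> \<and> map_kernel \<epsilon> \<in> X \<and> range \<epsilon> \<in> Y}"

section \<open>Trifle and burdened elements\<close>

text \<open>
  \<open>trifle_burdened \<alpha> a \<epsilon> k m\<close>: the elements \<open>a k\<close> and \<open>a m\<close> form the pair identified by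
  \<open>\<epsilon>\<close>, and their common image lies in \<open>A\<^sub>m\<close>. For an idempotent \<open>\<epsilon>\<close> of rank \<open>l - 1\<close>
  exactly one pair \<open>(k, m)\<close> satisfies this.
\<close>

definition trifle_burdened ::
    "('n \<Rightarrow> 'n) \<Rightarrow> (nat \<Rightarrow> 'n) \<Rightarrow> ('n \<Rightarrow> 'n) \<Rightarrow> nat \<Rightarrow> nat \<Rightarrow> bool" where
  "trifle_burdened \<alpha> a \<epsilon> k m \<longleftrightarrow>
     k \<in> {1..map_rank \<alpha>} \<and> m \<in> {1..map_rank \<alpha>} \<and> k \<noteq> m \<and>
     \<epsilon> (a m) = \<epsilon> (a k) \<and> \<epsilon> (a m) \<in> block \<alpha> a m"

definition trifle :: "('n \<Rightarrow> 'n) \<Rightarrow> (nat \<Rightarrow> 'n) \<Rightarrow> ('n \<Rightarrow> 'n) \<Rightarrow> 'n" where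
  "trifle \<alpha> a \<beta> =
     (THE t. \<exists>k m. trifle_burdened \<alpha> a (cyclic_idem (variant \<alpha>) \<beta>) k m \<and> t = a k)"

definition burdened :: "('n \<Rightarrow> 'n) \<Rightarrow> (nat \<Rightarrow> 'n) \<Rightarrow> ('n \<Rightarrow> 'n) \<Rightarrow> 'n" where
  "burdened \<alpha> a \<beta> =
     (THE b. \<exists>k m. trifle_burdened \<alpha> a (cyclic_idem (variant \<alpha>) \<beta>) k m \<and> b = a m)"

definition trifle_layer :: "('n \<Rightarrow> 'n) \<Rightarrow> (nat \<Rightarrow> 'n) \<Rightarrow> nat \<Rightarrow> ('n \<Rightarrow> 'n) set" where
  "trifle_layer \<alpha> a k = {\<beta> \<in> stable_layer \<alpha> (map_rank \<alpha> - 1). trifle \<alpha> a \<beta> = a k}"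

definition trifle_burdened_layer ::
    "('n \<Rightarrow> 'n) \<Rightarrow> (nat \<Rightarrow> 'n) \<Rightarrow> nat \<Rightarrow> nat \<Rightarrow> ('n \<Rightarrow> 'n) set" where
  "trifle_burdened_layer \<alpha> a k m = {\<beta> \<in> trifle_layer \<alpha> a k. burdened \<alpha> a \<beta> = a m}"

section \<open>The families of subsemigroups\<close>

definition U_all :: "('n \<Rightarrow> 'n) \<Rightarrow> (nat \<Rightarrow> 'n) \<Rightarrow> nat \<Rightarrow> nat \<Rightarrow> 'n set set set" where
  "U_all \<alpha> a k m = {P. partition_on UNIV P \<and> card P = map_rank \<alpha> - 1 \<and>
     (\<forall>B\<in>P. \<exists>i\<in>{1..map_rank \<alpha>}. a i \<in> B) \<and> (\<exists>B\<in>P. a k \<in> B \<and> a m \<in> B)}"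

definition V_all :: "('n \<Rightarrow> 'n) \<Rightarrow> (nat \<Rightarrow> 'n) \<Rightarrow> nat \<Rightarrow> 'n set set" where
  "V_all \<alpha> a k =
     {b ` ({1..map_rank \<alpha>} - {k}) | b. \<forall>i\<in>{1..map_rank \<alpha>} - {k}. b i \<in> block \<alpha> a i}"

definition H_set :: "('n \<Rightarrow> 'n) \<Rightarrow> (nat \<Rightarrow> 'n) \<Rightarrow> nat \<Rightarrow> nat \<Rightarrow>
    'n set set set \<Rightarrow> 'n set set \<Rightarrow> ('n \<Rightarrow> 'n) set" where
  "H_set \<alpha> a k m X Y = \<Union> {root_set (variant \<alpha>) \<epsilon> | \<epsilon>.
     idem (variant \<alpha>) \<epsilon> \<and> \<epsilon> \<in> trifle_burdened_layer \<alpha> a k m \<and>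
     map_kernel \<epsilon> \<in> X \<and> range \<epsilon> \<in> Y}"

text \<open>The first index parameter is the unordered pair \<open>{k, m}\<close>; both orders are covered by
  the existential quantifier.\<close>

definition K_set :: "('n \<Rightarrow> 'n) \<Rightarrow> (nat \<Rightarrow> 'n) \<Rightarrow> nat set \<Rightarrow>
    'n set set set \<Rightarrow> ('n \<Rightarrow> 'n) set" where
  "K_set \<alpha> a p X = \<Union> {root_set (variant \<alpha>) \<epsilon> | \<epsilon>.
     idem (variant \<alpha>) \<epsilon> \<and>
     (\<exists>k m. p = {k, m} \<and> k \<noteq> m \<and> \<epsilon> \<in> trifle_burdened_layer \<alpha> a k m) \<and>
     map_kernel \<epsilon> \<in> X}"

definition L_set :: "('n \<Rightarrow> 'n) \<Rightarrow> (nat \<Rightarrow> 'n) \<Rightarrow> nat \<Rightarrow>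
    'n set \<Rightarrow> 'n set set \<Rightarrow> ('n \<Rightarrow> 'n) set" where
  "L_set \<alpha> a k M Y = \<Union> {root_set (variant \<alpha>) \<epsilon> | \<epsilon>.
     idem (variant \<alpha>) \<epsilon> \<and> \<epsilon> \<in> trifle_layer \<alpha> a k \<and>
     burdened \<alpha> a \<epsilon> \<in> M \<and> range \<epsilon> \<in> Y}"

text \<open>
  An item of the classification together with its parameters. Having all parameters in one
  type makes ``different items or different choices of parameters give different sets''
  the injectivity of \<open>item_set\<close>; the pair in \<open>Item_K\<close> is unordered.
\<close>

datatype 'n item =
    Item_F "'n set set set" "'n set set"
  | Item_H nat nat "'n set set set" "'n set set"
  | Item_K "nat set" "'n set set set"
  | Item_L nat "'n set" "'n set set"
  | Item_Low
  | Item_F_Low "'n set set set" "'n set set"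

fun admissible :: "('n \<Rightarrow> 'n) \<Rightarrow> (nat \<Rightarrow> 'n) \<Rightarrow> 'n item \<Rightarrow> bool" where
  "admissible \<alpha> a (Item_F X Y) \<longleftrightarrow>
     X \<noteq> {} \<and> X \<subseteq> X_all \<alpha> a \<and> Y \<noteq> {} \<and> Y \<subseteq> Y_all \<alpha> a"
| "admissible \<alpha> a (Item_H k m X Y) \<longleftrightarrow>
     map_rank \<alpha> > 1 \<and> k \<in> {1..map_rank \<alpha>} \<and> m \<in> {1..map_rank \<alpha>} \<and> k \<noteq> m \<and>
     X \<noteq> {} \<and> X \<subseteq> U_all \<alpha> a k m \<and> Y \<noteq> {} \<and> Y \<subseteq> V_all \<alpha> a k"
| "admissible \<alpha> a (Item_K p X) \<longleftrightarrow>
     map_rank \<alpha> > 1 \<and>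
     (\<exists>k m. p = {k, m} \<and> {k, m} \<subseteq> {1..map_rank \<alpha>} \<and> k \<noteq> m \<and>
       X \<noteq> {} \<and> X \<subseteq> U_all \<alpha> a k m)"
| "admissible \<alpha> a (Item_L k M Y) \<longleftrightarrow>
     map_rank \<alpha> > 1 \<and> k \<in> {1..map_rank \<alpha>} \<and> Y \<noteq> {} \<and> Y \<subseteq> V_all \<alpha> a k \<and>
     M \<subseteq> a ` ({1..map_rank \<alpha>} - {k}) \<and> card M > 1"
| "admissible \<alpha> a Item_Low \<longleftrightarrow> map_rank \<alpha> > 2"
| "admissible \<alpha> a (Item_F_Low X Y) \<longleftrightarrow>
     map_rank \<alpha> > 1 \<and> X \<noteq> {} \<and> X \<subseteq> X_all \<alpha> a \<and> Y \<noteq> {} \<and> Y \<subseteq> Y_all \<alpha> a"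

fun item_set :: "('n \<Rightarrow> 'n) \<Rightarrow> (nat \<Rightarrow> 'n) \<Rightarrow> 'n item \<Rightarrow> ('n \<Rightarrow> 'n) set" where
  "item_set \<alpha> a (Item_F X Y) = F_set \<alpha> X Y"
| "item_set \<alpha> a (Item_H k m X Y) = H_set \<alpha> a k m X Y"
| "item_set \<alpha> a (Item_K p X) = K_set \<alpha> a p X"
| "item_set \<alpha> a (Item_L k M Y) = L_set \<alpha> a k M Y"
| "item_set \<alpha> a Item_Low = UNIV - stable_layer \<alpha> (map_rank \<alpha>)"
| "item_set \<alpha> a (Item_F_Low X Y) = F_set \<alpha> X Y \<union> (UNIV - stable_layer \<alpha> (map_rank \<alpha>))"

end

theory Submission
  imports Defs "HOL-Combinatorics.Transposition"
begin

text \<open>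
  The map \<open>\<beta> \<mapsto> \<alpha> \<circ> \<beta>\<close>, restricted to the image \<open>A\<close> of \<open>\<alpha>\<close>, is a homomorphism onto the full
  transformation semigroup of \<open>A\<close>, and an idempotent of the variant is determined by its kernel
  and its range. An isolated set is a union of classes of elements with the same idempotent
  power \<open>\<omega> x\<close>, so it is governed by the idempotents it contains.

  If an isolated subsemigroup contains two different stable ranks, then multiplying a smaller
  idempotent by the roots of a larger one that permute its range lowers the rank until a constant
  map appears; one constant yields all constants, and these yield everything of stable rank below
  \<open>l\<close>. If there is a single stable rank \<open>r\<close>, then \<open>r \<ge> l - 1\<close>, because two points \<open>p, q\<close> of
  \<open>A\<close> outside the image of an idempotent give two roots whose product has rank \<open>r + 1\<close>. For
  \<open>r = l\<close> the idempotents form a rectangular band of kernels and ranges. For \<open>r = l - 1\<close> two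
  elements cannot lower the rank of their product, which forces a common trifle element or a
  common pair; when the burdened (respectively, the trifle) element varies, suitable roots
  change the kernel (respectively, the range) one point at a time, so all of them occur.
\<close>

section \<open>Idempotent powers in finite semigroups\<close>

text \<open>Closure under products says little by itself; isolation contributes through roots. For
  \<open>x\<close> to be a root of an idempotent \<open>e\<close> it is enough that the square of
  \<open>x\<close> lies in the maximal subgroup of \<open>e\<close>, that is, equals
  \<open>e\<close> followed by a permutation of \<open>range e\<close>. The constructions inside a
  single stable rank therefore alter a member of that group at one point which \<alpha> does not
  reach from \<open>range e\<close>, so that the alteration disappears in the square but survives in
  a product with another member of \<open>T\<close>. The side conditions of the list remove
  coincidences. With a singleton \<open>M\<close>, an item of type \<open>L\<close> would equal the
  item of type \<open>H\<close> with the same ranges and all kernels. For \<open>l = 2\<close>, the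
  elements below full stable rank are the item of type \<open>K\<close> for the only pair and the
  one-block partition. That nothing else coincides is shown by reading the parameters back from the
  set: the stable ranks, kernels, ranges and (trifle, burdened) pairs that occur in it.\<close>

locale finite_semigroup = semigroup f for f :: "'a::finite \<Rightarrow> 'a \<Rightarrow> 'a"
begin

lemma sg_power_1: "sg_power f x 1 = x"
  by (simp add: sg_power_def)

lemma sg_power_Suc: "0 < j \<Longrightarrow> sg_power f x (Suc j) = f (sg_power f x j) x"
  by (cases j) (auto simp: sg_power_def)

lemma sg_power_add:
  assumes "0 < i" "0 < j"
  shows "f (sg_power f x i) (sg_power f x j) = sg_power f x (i + j)"
  using assms(2)
proof (induction j)
  case (Suc j)
  show ?case
  proof (cases "j = 0")
    case True
    then show ?thesis using assms(1) sg_power_1 sg_power_Suc by simp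
  next
    case False
    then show ?thesis using assms(1) Suc.IH by (simp add: sg_power_Suc flip: assoc)
  qed
qed simp

lemma sg_power_mult:
  assumes "0 < i" "0 < j"
  shows "sg_power f (sg_power f x i) j = sg_power f x (i * j)"
  using assms(2)
proof (induction j)
  case (Suc j)
  show ?case
  proof (cases "j = 0")
    case True
    then show ?thesis using sg_power_1 by simp
  next
    case False
    then show ?thesis using assms(1) Suc.IH
      by (simp add: sg_power_Suc sg_power_add add.commute)
  qed
qed simp

lemma idem_power:
  assumes "idem f e" "0 < j"
  shows "sg_power f e j = e"
  using assms(2)
proof (induction j)
  case (Suc j)
  then show ?case
    using assms(1) sg_power_1 by (cases "j = 0") (auto simp: sg_power_Suc idem_def)
qed simp

lemma ex_idem_power: "\<exists>j>0. idem f (sg_power f x j)"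
proof -
  have "\<not> inj (\<lambda>j. sg_power f x (Suc j))"
    using finite_imageD[of "\<lambda>j. sg_power f x (Suc j)" UNIV] by auto
  then obtain i j where "i < j" and "sg_power f x (Suc i) = sg_power f x (Suc j)"
    unfolding inj_def by (metis linorder_neqE_nat)
  then obtain d where d: "0 < d" "sg_power f x (Suc i) = sg_power f x (Suc i + d)"
    by (metis add_Suc less_imp_add_positive)
  have shift: "sg_power f x k = sg_power f x (k + d)" if "Suc i \<le> k" for k
  proof (cases "k = Suc i")
    case False
    then have "sg_power f x k = f (sg_power f x (Suc i)) (sg_power f x (k - Suc i))"
      using that by (simp add: sg_power_add)
    also have "\<dots> = f (sg_power f x (Suc i + d)) (sg_power f x (k - Suc i))"
      using d by simp
    also have "\<dots> = sg_power f x (k + d)"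
      using False that by (simp add: sg_power_add add.commute del: add_Suc)
    finally show ?thesis .
  qed (use d in simp)
  have mult: "sg_power f x k = sg_power f x (k + m * d)" if "Suc i \<le> k" for k m
  proof (induction m)
    case (Suc m)
    then show ?case using that shift[of "k + m * d"] by (simp add: add.commute add.left_commute)
  qed simp
  \<comment> \<open>A multiple of the period \<open>d\<close> that is at least the preperiod
    \<open>Suc i\<close>; doubling this exponent adds \<open>Suc i\<close> whole periods and changes
    nothing.\<close>
  let ?k = "Suc i * d"
  have "Suc i \<le> ?k" using d by (cases d) auto
  then have "sg_power f x (?k + ?k) = sg_power f x ?k"
    using mult[of ?k "Suc i"] by simp
  then have "idem f (sg_power f x ?k)"
    using d(1) unfolding idem_def by (subst sg_power_add) auto
  then show ?thesis using d(1) by (intro exI[of _ ?k]) auto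
qed

lemma idem_power_unique:
  assumes "0 < i" "0 < j" "idem f (sg_power f x i)" "idem f (sg_power f x j)"
  shows "sg_power f x i = sg_power f x j"
  by (metis assms idem_power mult.commute sg_power_mult)

lemma cyclic_idem_eqI:
  assumes "0 < j" "sg_power f x j = e" "idem f e"
  shows "cyclic_idem f x = e"
  unfolding cyclic_idem_def cyclic_subsemigroup_def
  using assms idem_power_unique by (intro the_equality) auto

lemma cyclic_idem_eq_power: "\<exists>j>0. sg_power f x j = cyclic_idem f x"
  using ex_idem_power cyclic_idem_eqI by metis

lemma idem_cyclic_idem: "idem f (cyclic_idem f x)"
  using ex_idem_power cyclic_idem_eqI by metis

lemma cyclic_idem_idem: "idem f e \<Longrightarrow> cyclic_idem f e = e"
  using cyclic_idem_eqI[of 1] sg_power_1 by simp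

lemma cyclic_idem_power:
  assumes "0 < j"
  shows "cyclic_idem f (sg_power f x j) = cyclic_idem f x"
proof -
  obtain i where i: "0 < i" "sg_power f x i = cyclic_idem f x"
    using cyclic_idem_eq_power by blast
  have "sg_power f (sg_power f x j) i = sg_power f (sg_power f x i) j"
    using i(1) assms by (simp add: sg_power_mult mult.commute)
  then have "sg_power f (sg_power f x j) i = cyclic_idem f x"
    using i assms idem_power idem_cyclic_idem by simp
  then show ?thesis using i(1) idem_cyclic_idem cyclic_idem_eqI by blast
qed

lemma cyclic_idem_square: "cyclic_idem f (f x x) = cyclic_idem f x"
  using cyclic_idem_power[of 2 x] sg_power_add[of 1 1 x] sg_power_1[of x]
  by (simp add: numeral_2_eq_2)

text \<open>The idempotent is one of the powers of \<open>x\<close>, so whatever survives right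
  multiplication by \<open>x\<close> reaches it. Later arguments thereby never mention
  exponents.\<close>

lemma cyclic_idem_induct:
  assumes "P x" "\<And>y. P y \<Longrightarrow> P (f y x)"
  shows "P (cyclic_idem f x)"
proof -
  have "P (sg_power f x j)" if "0 < j" for j
    using that
  proof (induction j)
    case (Suc j)
    then show ?case
      using assms sg_power_1 by (cases "j = 0") (auto simp: sg_power_Suc)
  qed simp
  then show ?thesis using cyclic_idem_eq_power by metis
qed

lemma cyclic_idem_commute: "f (cyclic_idem f x) x = f x (cyclic_idem f x)"
proof -
  obtain j where j: "0 < j" "sg_power f x j = cyclic_idem f x"
    using cyclic_idem_eq_power by blast
  then show ?thesis
    using sg_power_add[of j 1 x] sg_power_add[of 1 j x] sg_power_1[of x] by simp
qed

lemma cyclic_idem_inverse: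
  "\<exists>y. f (f (cyclic_idem f x) x) y = cyclic_idem f x \<and> f y (f x (cyclic_idem f x)) = cyclic_idem f x"
proof -
  obtain j where j: "0 < j" "sg_power f x j = cyclic_idem f x"
    using cyclic_idem_eq_power by blast
  \<comment> \<open>The exponent is \<open>2 * j - 1\<close> rather than \<open>j - 1\<close>,
    because for \<open>j = 1\<close> the latter would be zero and there is no unit.\<close>
  let ?e = "cyclic_idem f x" and ?y = "sg_power f x (2 * j - 1)"
  have ee: "f ?e ?e = ?e" using idem_cyclic_idem by (simp add: idem_def)
  have "sg_power f x (2 * j) = ?e"
    using sg_power_add[of j j x] j ee by (simp add: mult_2)
  moreover have "f x ?y = sg_power f x (2 * j)" "f ?y x = sg_power f x (2 * j)"
    using sg_power_add[of 1 "2 * j - 1" x] sg_power_add[of "2 * j - 1" 1 x] sg_power_1[of x] j(1)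
    by auto
  ultimately have "f (f ?e x) ?y = ?e" "f ?y (f x ?e) = ?e"
    using ee by (simp_all add: assoc) (simp flip: assoc)
  then show ?thesis by blast
qed

lemma root_set_idem: "idem f e \<Longrightarrow> root_set f e = {x. cyclic_idem f x = e}"
  using cyclic_idem_eqI cyclic_idem_eq_power unfolding root_set_def by blast

text \<open>All powers of \<open>x\<close> share one idempotent, so isolation is saturation under
  \<open>cyclic_idem\<close>. This is the form in which it is used throughout.\<close>

lemma isolated_subsemigroup_iff:
  "isolated_subsemigroup f T \<longleftrightarrow> subsemigroup f T \<and> (\<forall>x. cyclic_idem f x \<in> T \<longleftrightarrow> x \<in> T)"
proof safe
  assume T: "isolated_subsemigroup f T"
  then show "subsemigroup f T" by (simp add: isolated_subsemigroup_def)
  fix x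
  show "x \<in> T" if "cyclic_idem f x \<in> T"
    using that T cyclic_idem_eq_power[of x] unfolding isolated_subsemigroup_def by metis
  show "cyclic_idem f x \<in> T" if "x \<in> T"
    using that T unfolding isolated_subsemigroup_def subsemigroup_def
    by (rule_tac cyclic_idem_induct) auto
next
  assume "subsemigroup f T" and iff: "\<forall>x. cyclic_idem f x \<in> T \<longleftrightarrow> x \<in> T"
  then show "isolated_subsemigroup f T"
    unfolding isolated_subsemigroup_def using cyclic_idem_power iff by metis
qed

end

section \<open>Stable rank\<close>

locale idempotent_variant =
  fixes \<alpha> :: "'n::finite \<Rightarrow> 'n"
  assumes alpha_comp: "\<alpha> \<circ> \<alpha> = \<alpha>"
begin

sublocale finite_semigroup "variant \<alpha>"
  by unfold_locales (simp add: variant_def fun_eq_iff)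

abbreviation mult (infixl "\<star>" 70) where "x \<star> y \<equiv> variant \<alpha> x y"

abbreviation idempotent where "idempotent \<equiv> idem (variant \<alpha>)"

abbreviation \<omega> where "\<omega> \<equiv> cyclic_idem (variant \<alpha>)"

definition A :: "'n set" where "A = range \<alpha>"

lemma alpha_alpha [simp]: "\<alpha> (\<alpha> x) = \<alpha> x"
  using alpha_comp by (simp add: fun_eq_iff)

lemma alpha_in_A [simp]: "\<alpha> x \<in> A"
  by (simp add: A_def)

lemma alpha_fix [simp]: "c \<in> A \<Longrightarrow> \<alpha> c = c"
  by (auto simp: A_def)

lemma A_nonempty [simp]: "A \<noteq> {}"
  using alpha_in_A by blast

lemma mult_apply: "(x \<star> y) z = y (\<alpha> (x z))"
  by (simp add: variant_def)

lemma idem_iff: "idempotent e \<longleftrightarrow> (\<forall>z. e (\<alpha> (e z)) = e z)"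
  by (simp add: idem_def fun_eq_iff mult_apply)

section \<open>Idempotents of the variant, their ranges and kernels\<close>

lemma idem_fix: "idempotent e \<Longrightarrow> b \<in> range e \<Longrightarrow> e (\<alpha> b) = b"
  by (auto simp: idem_iff)

text \<open>On \<alpha>-images of its own range, \<open>e\<close> undoes \<alpha>; hence the rank of
  \<open>e\<close> is still visible after its range is pushed into \<open>A\<close>.\<close>

lemma idem_inj_on: "idempotent e \<Longrightarrow> inj_on \<alpha> (range e)"
  by (metis idem_fix inj_onI)

lemma idem_range: "idempotent e \<Longrightarrow> e ` A = range e"
  using idem_iff by (auto simp: image_iff) (metis alpha_in_A)

lemma idem_fix_image: "idempotent e \<Longrightarrow> c \<in> \<alpha> ` e ` A \<Longrightarrow> \<alpha> (e c) = c"
  by (auto simp: idem_iff)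

lemma map_rank_idem: "idempotent e \<Longrightarrow> map_rank e = card (\<alpha> ` e ` A)"
  by (simp add: map_rank_def idem_range card_image idem_inj_on)

lemma map_kernel_eq: "map_kernel x = range (\<lambda>z. {z'. x z = x z'})"
  by (auto simp: map_kernel_def quotient_def)

lemma map_kernel_eq_iff:
  "map_kernel x = map_kernel y \<longleftrightarrow> (\<forall>z z'. x z = x z' \<longleftrightarrow> y z = y z')"
proof
  assume eq: "map_kernel x = map_kernel y"
  have "{z'. x z = x z'} = {z'. y z = y z'}" for z
  proof -
    have "{z'. x z = x z'} \<in> map_kernel y"
      unfolding eq[symmetric] by (auto simp: map_kernel_eq)
    then obtain w where "{z'. x z = x z'} = {z'. y w = y z'}"
      unfolding map_kernel_eq by blast
    moreover from this have "y w = y z" by blast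
    ultimately show ?thesis by simp
  qed
  then show "\<forall>z z'. x z = x z' \<longleftrightarrow> y z = y z'" by blast
qed (simp add: map_kernel_eq)

lemma map_kernel_partition: "partition_on UNIV (map_kernel x)"
  by (rule partition_onI) (auto simp: map_kernel_eq disjnt_def)

lemma card_map_kernel: "card (map_kernel x) = map_rank x"
proof -
  have "map_kernel x = (\<lambda>b. x -` {b}) ` range x"
    unfolding map_kernel_eq image_image by (intro image_cong) auto
  moreover have "inj_on (\<lambda>b. x -` {b}) (range x)"
    by (rule inj_onI) auto
  ultimately show ?thesis by (simp add: card_image map_rank_def)
qed

text \<open>The value \<open>e z\<close> lies in \<open>range f\<close>, so \<open>f\<close> sends
  \<open>\<alpha> (e z)\<close> back to \<open>e z\<close>. But \<open>\<alpha> (e z)\<close> also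
  lies in the common kernel class of \<open>z\<close>, so \<open>f\<close> sends it to
  \<open>f z\<close>.\<close>

lemma idem_eqI:
  assumes "idempotent e" "idempotent f" "map_kernel e = map_kernel f" "range e = range f"
  shows "e = f"
proof
  fix z
  have "f (\<alpha> (e z)) = e z"
    using assms(2,4) idem_fix by blast
  moreover have "f (\<alpha> (e z)) = f z"
    using assms(1,3) idem_iff map_kernel_eq_iff by metis
  ultimately show "e z = f z" by simp
qed

text \<open>The test by which all unusual roots are recognised. Only the square of \<open>x\<close>
  is constrained: it must belong to the group of maps \<open>\<sigma> \<circ> e\<close> with
  \<open>\<sigma>\<close> a permutation of \<open>range e\<close>, and passing to the square does
  not change the idempotent.\<close>

lemma cyclic_idem_eq_if_square:
  assumes e: "idempotent e" and sq: "x \<star> x = \<rho> \<circ> e"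
    and \<rho>: "inj_on \<rho> (range e)" "\<rho> ` range e \<subseteq> range e"
  shows "\<omega> x = e"
proof -
  have "\<exists>\<sigma>. inj_on \<sigma> (range e) \<and> \<sigma> ` range e \<subseteq> range e \<and> \<omega> (x \<star> x) = \<sigma> \<circ> e"
  proof (rule cyclic_idem_induct)
    show "\<exists>\<sigma>. inj_on \<sigma> (range e) \<and> \<sigma> ` range e \<subseteq> range e \<and> x \<star> x = \<sigma> \<circ> e"
      using sq \<rho> by blast
    fix y
    assume "\<exists>\<sigma>. inj_on \<sigma> (range e) \<and> \<sigma> ` range e \<subseteq> range e \<and> y = \<sigma> \<circ> e"
    then obtain \<sigma> where \<sigma>: "inj_on \<sigma> (range e)" "\<sigma> ` range e \<subseteq> range e" "y = \<sigma> \<circ> e"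
      by blast
    have "e (\<alpha> (\<sigma> (e z))) = \<sigma> (e z)" for z
      using \<sigma>(2) e idem_fix by blast
    then have "y \<star> (x \<star> x) = (\<rho> \<circ> \<sigma>) \<circ> e"
      by (simp add: sq \<sigma>(3) fun_eq_iff mult_apply)
    moreover have "inj_on (\<rho> \<circ> \<sigma>) (range e)"
      using \<rho> \<sigma> by (meson comp_inj_on inj_on_subset)
    moreover have "(\<rho> \<circ> \<sigma>) ` range e \<subseteq> range e"
      using \<rho>(2) \<sigma>(2) by fastforce
    ultimately show "\<exists>\<sigma>. inj_on \<sigma> (range e) \<and> \<sigma> ` range e \<subseteq> range e \<and> y \<star> (x \<star> x) = \<sigma> \<circ> e"
      by blast
  qed
  then obtain \<sigma> where \<sigma>: "inj_on \<sigma> (range e)" "\<sigma> ` range e \<subseteq> range e" "\<omega> x = \<sigma> \<circ> e"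
    by (auto simp: cyclic_idem_square)
  \<comment> \<open>Idempotency of \<open>\<sigma> \<circ> e\<close> makes \<open>\<sigma>\<close>
    idempotent on \<open>range e\<close>; being injective there, it is the identity.\<close>
  have "\<sigma> (e z) = e z" for z
  proof -
    have "e (\<alpha> (\<sigma> (e z))) = \<sigma> (e z)"
      using \<sigma>(2) e idem_fix by blast
    then have "\<sigma> (\<sigma> (e z)) = \<sigma> (e z)"
      using idem_cyclic_idem[of x] by (auto simp: \<sigma>(3) idem_iff) metis
    then show ?thesis using \<sigma>(1,2) by (auto dest!: inj_onD)
  qed
  then show ?thesis by (simp add: \<sigma>(3) fun_eq_iff)
qed

section \<open>Stable rank and the action on \<open>A\<close>\<close>

lemma range_mult_subset: "range (x \<star> y) \<subseteq> range y"
  by (auto simp: mult_apply)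

lemma range_cyclic_idem_subset: "range (\<omega> x) \<subseteq> range x"
  by (rule cyclic_idem_induct) (use range_mult_subset in auto)

lemma cyclic_idem_cyclic_idem [simp]: "\<omega> (\<omega> x) = \<omega> x"
  by (simp add: cyclic_idem_idem idem_cyclic_idem)

lemma stable_rank_cyclic_idem [simp]: "stable_rank \<alpha> (\<omega> x) = stable_rank \<alpha> x"
  by (simp add: stable_rank_def)

lemma stable_rank_idem: "idempotent e \<Longrightarrow> stable_rank \<alpha> e = card (range e)"
  by (simp add: stable_rank_def cyclic_idem_idem map_rank_def)

lemma stable_rank_le_card_range: "stable_rank \<alpha> x \<le> card (range x)"
  unfolding stable_rank_def map_rank_def by (simp add: card_mono range_cyclic_idem_subset)

lemma stable_rank_le_square: "stable_rank \<alpha> x \<le> card (range (x \<star> x))"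
  using stable_rank_le_card_range[of "x \<star> x"] by (simp add: stable_rank_def cyclic_idem_square)

lemma stable_rank_pos: "0 < stable_rank \<alpha> x"
  by (simp add: stable_rank_def map_rank_def card_gt_0_iff)

lemma stable_rank_eq: "stable_rank \<alpha> x = card (\<alpha> ` \<omega> x ` A)"
  by (simp add: stable_rank_def map_rank_idem idem_cyclic_idem)

lemma stable_rank_le: "stable_rank \<alpha> x \<le> card A"
  unfolding stable_rank_eq by (auto intro!: card_mono)

lemma image_mult: "\<alpha> ` (x \<star> y) ` C = \<alpha> ` y ` \<alpha> ` x ` C"
  by (simp add: mult_apply image_image)

lemma image_cyclic_idem_subset: "\<alpha> ` \<omega> x ` A \<subseteq> \<alpha> ` x ` A"
proof (rule cyclic_idem_induct)
  show "\<alpha> ` (y \<star> x) ` A \<subseteq> \<alpha> ` x ` A" for y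
    unfolding image_mult by (intro image_mono) auto
qed simp

lemma stable_rank_full_iff: "stable_rank \<alpha> x = card A \<longleftrightarrow> \<alpha> ` x ` A = A"
proof
  assume "stable_rank \<alpha> x = card A"
  then have "\<alpha> ` \<omega> x ` A = A"
    unfolding stable_rank_eq by (intro card_subset_eq) auto
  then show "\<alpha> ` x ` A = A"
    using image_cyclic_idem_subset[of x] by auto
next
  assume x: "\<alpha> ` x ` A = A"
  have "\<alpha> ` \<omega> x ` A = A"
    by (rule cyclic_idem_induct) (simp_all add: image_mult x)
  then show "stable_rank \<alpha> x = card A"
    by (simp add: stable_rank_eq)
qed

text \<open>Full stable rank means that \<open>\<alpha> \<circ> x\<close> permutes the finite set
  \<open>A\<close>, and a composition of self-maps of a finite set is a permutation only if both
  factors are.\<close>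

lemma stable_rank_mult_full_iff:
  "stable_rank \<alpha> (x \<star> y) = card A \<longleftrightarrow> stable_rank \<alpha> x = card A \<and> stable_rank \<alpha> y = card A"
proof -
  have "\<alpha> ` x ` A = A" "\<alpha> ` y ` A = A" if "\<alpha> ` y ` \<alpha> ` x ` A = A"
  proof -
    have sub: "\<alpha> ` y ` \<alpha> ` x ` A \<subseteq> \<alpha> ` y ` A" by (intro image_mono) auto
    then show "\<alpha> ` y ` A = A" using that by auto
    have "card A \<le> card (\<alpha> ` x ` A)"
      using that card_image_le[of "\<alpha> ` x ` A" "\<alpha> \<circ> y"] by (simp add: image_comp)
    then show "\<alpha> ` x ` A = A"
      by (intro card_seteq) auto
  qed
  then show ?thesis
    unfolding stable_rank_full_iff image_mult by auto
qed

lemma idem_full_fix: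
  assumes "stable_rank \<alpha> x = card A" "c \<in> A"
  shows "\<alpha> (\<omega> x c) = c"
proof -
  have "\<alpha> ` \<omega> x ` A = A"
    using assms(1) stable_rank_full_iff[of "\<omega> x"] by simp
  then show ?thesis
    using assms(2) idem_fix_image idem_cyclic_idem by metis
qed

section \<open>Kernel and range of the idempotent power of a product\<close>

text \<open>The element \<open>\<omega> x \<star> x = x \<star> \<omega> x\<close> lies in the maximal subgroup of \<open>\<omega> x\<close>, hence shares
  its kernel and its range.\<close>

lemma kernel_cyclic_idem_iff:
  "\<omega> x z = \<omega> x z' \<longleftrightarrow> \<omega> x (\<alpha> (x z)) = \<omega> x (\<alpha> (x z'))"
proof -
  obtain y where y: "(\<omega> x \<star> x) \<star> y = \<omega> x"
    using cyclic_idem_inverse by blast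
  have "x (\<alpha> (\<omega> x w)) = \<omega> x (\<alpha> (x w))" for w
    using fun_cong[OF cyclic_idem_commute[of x], of w] by (simp add: mult_apply)
  moreover have "\<omega> x w = y (\<alpha> (x (\<alpha> (\<omega> x w))))" for w
    using fun_cong[OF y, of w] by (simp add: mult_apply)
  ultimately show ?thesis by metis
qed

lemma range_cyclic_idem: "range (\<omega> x) = x ` \<alpha> ` range (\<omega> x)"
proof -
  obtain y where y: "y \<star> (x \<star> \<omega> x) = \<omega> x"
    using cyclic_idem_inverse by blast
  have com: "\<omega> x \<star> x = x \<star> \<omega> x" by (rule cyclic_idem_commute)
  have "range (\<omega> x) \<subseteq> range (\<omega> x \<star> x)"
    using range_mult_subset[of y "x \<star> \<omega> x"] y com by simp
  moreover have "range (\<omega> x \<star> x) \<subseteq> range (\<omega> x)"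
    unfolding com by (rule range_mult_subset)
  ultimately show ?thesis
    by (auto simp: mult_apply image_image)
qed

text \<open>By \<open>kernel_cyclic_idem_iff\<close>, \<open>z\<close> may be replaced by the point
  \<open>\<alpha> (x z)\<close> of \<open>A\<close>. So it is enough to compare kernels on
  \<open>A\<close>, even though the conclusion concerns all points.\<close>

lemma map_kernel_cyclic_idem_mult:
  assumes xy: "\<And>c d. c \<in> A \<Longrightarrow> d \<in> A \<Longrightarrow> \<omega> x c = \<omega> x d \<longleftrightarrow> \<omega> y c = \<omega> y d"
    and ym: "\<And>c d. c \<in> A \<Longrightarrow> d \<in> A \<Longrightarrow> \<omega> y c = \<omega> y d \<longleftrightarrow> \<omega> (x \<star> y) c = \<omega> (x \<star> y) d"
  shows "map_kernel (\<omega> (x \<star> y)) = map_kernel (\<omega> x)"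
proof -
  let ?w = "x \<star> y"
  have "\<omega> x z = \<omega> x z' \<longleftrightarrow> \<omega> ?w z = \<omega> ?w z'" for z z'
  proof -
    have "\<omega> x z = \<omega> x z' \<longleftrightarrow> \<omega> x (\<alpha> (x z)) = \<omega> x (\<alpha> (x z'))"
      by (rule kernel_cyclic_idem_iff)
    also have "\<dots> \<longleftrightarrow> \<omega> y (\<alpha> (x z)) = \<omega> y (\<alpha> (x z'))"
      by (rule xy) auto
    also have "\<dots> \<longleftrightarrow> \<omega> y (\<alpha> (?w z)) = \<omega> y (\<alpha> (?w z'))"
      using kernel_cyclic_idem_iff[of y "\<alpha> (x z)" "\<alpha> (x z')"] by (simp add: mult_apply)
    also have "\<dots> \<longleftrightarrow> \<omega> ?w (\<alpha> (?w z)) = \<omega> ?w (\<alpha> (?w z'))"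
      by (rule ym) auto
    also have "\<dots> \<longleftrightarrow> \<omega> ?w z = \<omega> ?w z'"
      by (rule kernel_cyclic_idem_iff[symmetric])
    finally show ?thesis .
  qed
  then show ?thesis unfolding map_kernel_eq_iff by blast
qed

lemma range_cyclic_idem_mult:
  assumes "\<alpha> ` range (\<omega> x) = \<alpha> ` range (\<omega> y)" "\<alpha> ` range (\<omega> (x \<star> y)) = \<alpha> ` range (\<omega> y)"
  shows "range (\<omega> (x \<star> y)) = range (\<omega> y)"
proof -
  have "range (\<omega> (x \<star> y)) = (x \<star> y) ` \<alpha> ` range (\<omega> x)"
    using range_cyclic_idem[of "x \<star> y"] assms by simp
  also have "\<dots> = y ` \<alpha> ` x ` \<alpha> ` range (\<omega> x)"
    by (simp add: mult_apply image_image)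
  also have "\<dots> = range (\<omega> y)"
    using assms(1) range_cyclic_idem[of x] range_cyclic_idem[of y] by simp
  finally show ?thesis .
qed

section \<open>Permutations of the range of an idempotent\<close>

lemma ex_move_pair:
  assumes "c1 \<in> B" "c2 \<in> B" "c1 \<noteq> c2" "p \<in> B" "q \<in> B" "p \<noteq> q"
  obtains \<pi> where "bij_betw \<pi> B B" "\<pi> c1 = p" "\<pi> c2 = q"
proof
  \<comment> \<open>The second transposition acts on the point to which the first one has moved
    \<open>c2\<close>; that point and \<open>q\<close> both differ from \<open>p\<close>, so
    \<open>c1\<close> stays at \<open>p\<close>.\<close>
  let ?\<pi> = "transpose (transpose c1 p c2) q \<circ> transpose c1 p"
  have swap: "bij_betw (transpose u v) B B" if "u \<in> B" "v \<in> B" for u v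
    using that by (intro bij_betw_byWitness[where f' = "transpose u v"]) (auto simp: transpose_def)
  have "transpose c1 p c2 \<in> B" using assms by (auto simp: transpose_def)
  then show "bij_betw ?\<pi> B B"
    using assms by (intro bij_betw_trans[OF swap swap])
  show "?\<pi> c1 = p" "?\<pi> c2 = q"
    using assms by (auto simp: transpose_def)
qed

lemma cyclic_idem_comp_perm:
  assumes e: "idempotent e" and \<pi>: "bij_betw \<pi> (range e) (range e)"
  shows "\<omega> (\<pi> \<circ> e) = e"
proof (rule cyclic_idem_eq_if_square[OF e, where \<rho> = "\<pi> \<circ> \<pi>"])
  have "e (\<alpha> (\<pi> (e z))) = \<pi> (e z)" for z
    by (rule idem_fix[OF e]) (use \<pi> in \<open>auto simp: bij_betw_def\<close>)
  then show "(\<pi> \<circ> e) \<star> (\<pi> \<circ> e) = (\<pi> \<circ> \<pi>) \<circ> e"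
    by (simp add: fun_eq_iff mult_apply)
  have \<pi>\<pi>: "bij_betw (\<pi> \<circ> \<pi>) (range e) (range e)"
    using \<pi> bij_betw_trans by blast
  show "inj_on (\<pi> \<circ> \<pi>) (range e)" "(\<pi> \<circ> \<pi>) ` range e \<subseteq> range e"
    using \<pi>\<pi> by (auto simp: bij_betw_def)
qed

section \<open>Isolated subsemigroups of several stable ranks\<close>

lemma isolated_mult:
  "isolated_subsemigroup (variant \<alpha>) T \<Longrightarrow> x \<in> T \<Longrightarrow> y \<in> T \<Longrightarrow> x \<star> y \<in> T"
  by (simp add: isolated_subsemigroup_def subsemigroup_def)

lemma isolated_cyclic_idem:
  "isolated_subsemigroup (variant \<alpha>) T \<Longrightarrow> \<omega> x \<in> T \<longleftrightarrow> x \<in> T"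
  using isolated_subsemigroup_iff by blast

lemma isolated_ex: "isolated_subsemigroup (variant \<alpha>) T \<Longrightarrow> \<exists>x. x \<in> T"
  by (auto simp: isolated_subsemigroup_def subsemigroup_def)

text \<open>If \<open>f\<close> merges points of the \<alpha>-image of \<open>range e\<close>,
  already \<open>e \<star> f\<close> is smaller. Otherwise, by counting, \<open>e\<close> merges the
  \<alpha>-images of two points \<open>p, q\<close> of the larger \<open>range f\<close>; a root
  \<open>\<pi> \<circ> f\<close> places two values of \<open>e \<star> f\<close> on them, and a
  final factor \<open>e\<close> identifies these.\<close>

lemma ex_smaller_stable_rank:
  assumes T: "isolated_subsemigroup (variant \<alpha>) T"
    and e: "e \<in> T" "idempotent e" "1 < card (range e)"
    and f: "f \<in> T" "idempotent f" "card (range e) < card (range f)"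
  shows "\<exists>w\<in>T. stable_rank \<alpha> w < card (range e)"
proof -
  note mult = isolated_mult[OF T] and iso = isolated_cyclic_idem[OF T]
  let ?D = "\<alpha> ` range e"
  have card_D: "card ?D = card (range e)"
    using idem_inj_on[OF e(2)] by (rule card_image)
  show ?thesis
  proof (cases "inj_on f ?D")
    case False
    then have "card (f ` ?D) < card ?D"
      using card_image_le[of ?D f] eq_card_imp_inj_on[of ?D f] by fastforce
    moreover have "range (e \<star> f) = f ` ?D"
      by (auto simp: mult_apply)
    ultimately have "stable_rank \<alpha> (e \<star> f) < card (range e)"
      using stable_rank_le_card_range[of "e \<star> f"] card_D by simp
    then show ?thesis using mult e(1) f(1) by blast
  next
    case True
    let ?C = "f ` ?D"
    have card_C: "card ?C = card (range e)"
      using True card_D by (simp add: card_image)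
    obtain c1 c2 where c: "c1 \<in> ?C" "c2 \<in> ?C" "c1 \<noteq> c2"
      using e(3) card_C by (metis card_le_Suc0_iff_eq finite One_nat_def not_less)
    have "\<not> inj_on (e \<circ> \<alpha>) (range f)"
    proof
      assume "inj_on (e \<circ> \<alpha>) (range f)"
      then have "card (range f) \<le> card (range e)"
        by (rule card_inj_on_le) auto
      then show False using f(3) by simp
    qed
    then obtain p q where pq: "p \<in> range f" "q \<in> range f" "p \<noteq> q" "e (\<alpha> p) = e (\<alpha> q)"
      unfolding inj_on_def by auto
    obtain \<pi> where \<pi>: "bij_betw \<pi> (range f) (range f)" "\<pi> c1 = p" "\<pi> c2 = q"
      using ex_move_pair[of c1 "range f" c2 p q] c pq by blast
    let ?w = "(e \<star> (\<pi> \<circ> f)) \<star> e"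
    have "\<omega> (\<pi> \<circ> f) = f"
      using f(2) \<pi>(1) by (rule cyclic_idem_comp_perm)
    then have "\<pi> \<circ> f \<in> T"
      using iso f(1) by metis
    then have w: "?w \<in> T" using mult e(1) by blast
    have "range ?w = (e \<circ> \<alpha> \<circ> \<pi>) ` ?C"
      by (auto simp: mult_apply image_iff)
    moreover have "\<not> inj_on (e \<circ> \<alpha> \<circ> \<pi>) ?C"
    proof
      assume "inj_on (e \<circ> \<alpha> \<circ> \<pi>) ?C"
      from inj_onD[OF this _ c(1,2)] show False using c(3) pq(4) \<pi>(2,3) by simp
    qed
    ultimately have "card (range ?w) < card ?C"
      using card_image_le[of ?C "e \<circ> \<alpha> \<circ> \<pi>"] eq_card_imp_inj_on[of ?C "e \<circ> \<alpha> \<circ> \<pi>"] by fastforce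
    then show ?thesis
      using w stable_rank_le_card_range[of ?w] card_C by force
  qed
qed

lemma ex_stable_rank_1:
  assumes T: "isolated_subsemigroup (variant \<alpha>) T"
    and "x \<in> T" "y \<in> T" "stable_rank \<alpha> x < stable_rank \<alpha> y"
  shows "\<exists>x\<in>T. stable_rank \<alpha> x = 1"
  using assms(2,4)
proof (induction "stable_rank \<alpha> x" arbitrary: x rule: less_induct)
  case less
  note iso = isolated_cyclic_idem[OF T]
  show ?case
  proof (cases "stable_rank \<alpha> x = 1")
    case False
    have card: "card (range (\<omega> z)) = stable_rank \<alpha> z" for z
      by (simp add: stable_rank_def map_rank_def)
    have "1 < stable_rank \<alpha> x"
      using False stable_rank_pos[of x] by linarith
    then obtain w where "w \<in> T" "stable_rank \<alpha> w < stable_rank \<alpha> x"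
      using ex_smaller_stable_rank[OF T, of "\<omega> x" "\<omega> y"] iso less.prems assms(3)
        idem_cyclic_idem card by metis
    then show ?thesis using less by auto
  qed (use less in blast)
qed

lemma const_in_isolated:
  assumes T: "isolated_subsemigroup (variant \<alpha>) T"
    and "x \<in> T" "y \<in> T" "stable_rank \<alpha> x < stable_rank \<alpha> y"
  shows "(\<lambda>_. b) \<in> T"
proof -
  note mult = isolated_mult[OF T] and iso = isolated_cyclic_idem[OF T]
  obtain u where u: "u \<in> T" "stable_rank \<alpha> u = 1"
    using ex_stable_rank_1 assms by blast
  then obtain b0 where "range (\<omega> u) = {b0}"
    by (metis card_1_singletonE stable_rank_def map_rank_def)
  then have "\<omega> u = (\<lambda>_. b0)" by (auto simp: fun_eq_iff)
  then have b0: "(\<lambda>_. b0) \<in> T" using u iso by metis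
  define f where "f = \<omega> y"
  have f: "f \<in> T" "idempotent f" "1 < card (range f)"
    using assms iso idem_cyclic_idem[of y] stable_rank_pos[of x]
    unfolding f_def by (auto simp: stable_rank_def map_rank_def)
  have const: "(\<lambda>_. c) \<in> T" if c: "c \<in> range f" for c
  proof -
    \<comment> \<open>The constant \<open>b0\<close> times \<open>f\<close> has the value
      \<open>f (\<alpha> b0)\<close>; this root of \<open>f\<close> redirects it to
      \<open>c\<close>.\<close>
    let ?\<pi> = "transpose (f (\<alpha> b0)) c"
    have "bij_betw ?\<pi> (range f) (range f)"
      using c by (intro bij_betw_byWitness[where f' = ?\<pi>]) (auto simp: transpose_def)
    then have "?\<pi> \<circ> f \<in> T"
      using f cyclic_idem_comp_perm iso by metis
    then have "(\<lambda>_. b0) \<star> (?\<pi> \<circ> f) \<in> T"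
      using b0 mult by blast
    moreover have "(\<lambda>_. b0) \<star> (?\<pi> \<circ> f) = (\<lambda>_. c)"
      by (simp add: fun_eq_iff mult_apply)
    ultimately show ?thesis by simp
  qed
  obtain c1 c2 where c12: "c1 \<in> range f" "c2 \<in> range f" "c1 \<noteq> c2"
    using f(3) by (metis card_le_Suc0_iff_eq finite One_nat_def not_less)
  then have "\<alpha> c1 \<noteq> \<alpha> c2"
    using idem_inj_on[OF f(2)] by (auto dest: inj_onD)
  \<comment> \<open>Two points with different \<alpha>-images cannot both agree with
    \<open>b\<close> under \<alpha>; \<open>c'\<close> is one that does not. Then neither
    \<open>b\<close> nor \<open>c\<close> leads back to \<open>\<alpha> c'\<close>, so the map
    \<open>?x\<close> squares to the constant \<open>c\<close> although it takes the value
    \<open>b\<close>.\<close>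
  then obtain c c' where c: "c \<in> range f" "c' \<in> range f" "\<alpha> c \<noteq> \<alpha> c'" "\<alpha> c' \<noteq> \<alpha> b"
    using c12 by metis
  let ?x = "\<lambda>z. if z = \<alpha> c' then b else c"
  have "?x \<star> ?x = (\<lambda>_. c)"
    using c by (auto simp: fun_eq_iff mult_apply)
  moreover have "\<omega> (?x \<star> ?x) = \<omega> ?x"
    by (rule cyclic_idem_square)
  moreover have "\<omega> (\<lambda>_. c) = (\<lambda>_. c)"
    by (rule cyclic_idem_idem) (simp add: idem_iff)
  ultimately have "?x \<in> T"
    using const[OF c(1)] iso by metis
  then have "(\<lambda>_. c') \<star> ?x \<in> T" using const[OF c(2)] mult by blast
  moreover have "(\<lambda>_. c') \<star> ?x = (\<lambda>_. b)"
    by (simp add: fun_eq_iff mult_apply)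
  ultimately show ?thesis by simp
qed

lemma low_stable_rank_in_isolated:
  assumes T: "isolated_subsemigroup (variant \<alpha>) T"
    and "x \<in> T" "y \<in> T" "stable_rank \<alpha> x < stable_rank \<alpha> y"
    and "stable_rank \<alpha> z < card A"
  shows "z \<in> T"
proof -
  note mult = isolated_mult[OF T] and iso = isolated_cyclic_idem[OF T]
  have "z \<in> T" if "stable_rank \<alpha> z = r" "r < card A" for r z
    using that
  proof (induction r arbitrary: z rule: less_induct)
    case (less r)
    define e where "e = \<omega> z"
    have e: "idempotent e" "card (range e) = r"
      using less.prems idem_cyclic_idem by (auto simp: e_def stable_rank_def map_rank_def)
    have efix: "e (\<alpha> (e w)) = e w" for w
      using e(1) idem_iff by blast
    have "e \<in> T"
    proof (cases "r = 1")
      case True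
      then obtain b0 where "range e = {b0}"
        using e(2) by (metis card_1_singletonE)
      then have "e = (\<lambda>_. b0)" by (auto simp: fun_eq_iff)
      then show ?thesis using const_in_isolated[OF assms(1-4)] by simp
    next
      case False
      then have r: "1 < r" using stable_rank_pos[of z] less.prems by linarith
      have "card (\<alpha> ` range e) < card A"
        using e less.prems idem_inj_on by (simp add: card_image)
      then have "\<not> A \<subseteq> \<alpha> ` range e"
        using card_mono[of "\<alpha> ` range e" A] by fastforce
      then obtain k where k: "k \<in> A" "k \<notin> \<alpha> ` range e" by blast
      have \<alpha>k: "\<alpha> k = k" "\<alpha> (e w) \<noteq> k" for w
        using alpha_fix[OF k(1)] k(2) by (simp, metis rangeI imageI)
      \<comment> \<open>The value to be parked at \<open>k\<close> is that of \<open>k\<close>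
        itself. So the map \<open>?x\<close> below sends \<open>k\<close> to \<open>k\<close>, and
        its square cannot restore \<open>b1\<close>.\<close>
      define b1 where "b1 = e k"
      have "\<exists>b2\<in>range e. b2 \<noteq> b1"
      proof (rule ccontr)
        assume "\<not> ?thesis"
        then have "range e \<subseteq> {b1}" by blast
        then show False using r e(2) card_mono[of "{b1}" "range e"] by simp
      qed
      then obtain b2 where b2: "b2 \<in> range e" "b2 \<noteq> b1" by blast
      have eb: "e (\<alpha> b1) = b1" "e (\<alpha> b2) = b2" "\<alpha> b1 \<noteq> k" "\<alpha> b2 \<noteq> k"
        using b2(1) e(1) \<alpha>k by (auto simp: b1_def idem_fix)
      \<comment> \<open>\<open>?x\<close> parks \<open>b1\<close> at \<open>k\<close> and shifts
        \<open>b2\<close> to \<open>b1\<close>; \<open>?y\<close> undoes both, so the product is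
        \<open>e\<close>. In the square of \<open>?x\<close> the classes of \<open>b1\<close> and
        \<open>b2\<close> both end at \<open>k\<close>, in the square of \<open>?y\<close> both end
        at \<open>b2\<close>, which costs one value each.\<close>
      let ?x = "\<lambda>z. if e z = b1 then k else if e z = b2 then b1 else e z"
      let ?y = "\<lambda>z. if z = k then b1 else if e z = b1 then b2 else e z"
      have xy: "?x \<star> ?y = e"
        using eb \<alpha>k by (auto simp: fun_eq_iff mult_apply efix)
      have "range (?x \<star> ?x) \<subseteq> insert k (range e - {b1, b2})"
        using eb \<alpha>k b2 by (auto simp: mult_apply efix b1_def)
      then have "card (range (?x \<star> ?x)) \<le> card (insert k (range e - {b1, b2}))"
        by (intro card_mono) auto
      also have "\<dots> \<le> Suc (card (range e - {b1, b2}))"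
        by (rule card_insert_le_m1) auto
      also have "\<dots> < r"
        using b2 e(2) r by (subst card_Diff_subset) (auto simp: b1_def)
      finally have "stable_rank \<alpha> ?x < r"
        using stable_rank_le_square[of ?x] by linarith
      then have x: "?x \<in> T" using less.IH less.prems(2) less_trans by blast
      have "range (?y \<star> ?y) \<subseteq> range e - {b1}"
        using eb \<alpha>k b2 by (auto simp: mult_apply efix b1_def split: if_splits)
      then have "card (range (?y \<star> ?y)) \<le> card (range e - {b1})"
        by (intro card_mono) auto
      also have "\<dots> < r"
        using e(2) r by (subst card_Diff_subset) (auto simp: b1_def)
      finally have "stable_rank \<alpha> ?y < r"
        using stable_rank_le_square[of ?y] by linarith
      then have y: "?y \<in> T" using less.IH less.prems(2) less_trans by blast
      show ?thesis using mult[OF x y] xy by simp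
    qed
    then show ?case using iso by (simp add: e_def)
  qed
  then show ?thesis using assms(5) by blast
qed

lemma stable_rank_of_layer:
  assumes T: "isolated_subsemigroup (variant \<alpha>) T"
    and layer: "\<And>x. x \<in> T \<Longrightarrow> stable_rank \<alpha> x = r"
  shows "r = card A \<or> r = card A - 1"
proof (rule ccontr)
  assume contr: "\<not> ?thesis"
  note mult = isolated_mult[OF T] and iso = isolated_cyclic_idem[OF T]
  obtain x0 where x0: "x0 \<in> T"
    using isolated_ex[OF T] by blast
  define e where "e = \<omega> x0"
  have e: "e \<in> T" "idempotent e" "card (range e) = r"
    using x0 iso idem_cyclic_idem layer[OF x0]
    by (auto simp: e_def stable_rank_def map_rank_def)
  have efix: "e (\<alpha> (e w)) = e w" for w
    using e(2) idem_iff by blast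
  have "r \<le> card A" using stable_rank_le[of x0] layer[OF x0] by simp
  then have r: "r + 2 \<le> card A" using contr by linarith
  have "card (A - \<alpha> ` range e) = card A - r"
    using e idem_inj_on by (subst card_Diff_subset) (auto simp: card_image)
  then have "1 < card (A - \<alpha> ` range e)" using r by simp
  then obtain p q where "p \<in> A - \<alpha> ` range e" "q \<in> A - \<alpha> ` range e" and pq: "p \<noteq> q"
    by (metis card_le_Suc0_iff_eq finite One_nat_def not_less)
  then have \<alpha>pq: "\<alpha> p = p" "\<alpha> q = q" "\<And>w. \<alpha> (e w) \<noteq> p" "\<And>w. \<alpha> (e w) \<noteq> q"
    using alpha_fix[of p] alpha_fix[of q]
    by (simp, simp, metis DiffD2 rangeI imageI, metis DiffD2 rangeI imageI)
  \<comment> \<open>The roots will send \<open>p\<close> to \<open>q\<close> and \<open>q\<close> to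
    \<open>p\<close>, respectively. For the square of the first to agree with \<open>e\<close> at
    \<open>p\<close>, its value at \<open>q\<close> must be \<open>e p\<close>, and symmetrically
    for the second. Exchanging \<open>e p\<close> and \<open>e q\<close> achieves this and squares
    to \<open>e\<close>.\<close>
  define g where "g = transpose (e p) (e q) \<circ> e"
  have ge: "e (\<alpha> (g w)) = g w" "g (\<alpha> (e w)) = g w" for w
    unfolding g_def by (auto simp: transpose_def efix)
  have \<alpha>g: "\<alpha> (g w) \<noteq> p" "\<alpha> (g w) \<noteq> q" for w
    using \<alpha>pq unfolding g_def by (auto simp: transpose_def)
  have gg: "g (\<alpha> (g w)) = e w" for w
  proof -
    have "g (\<alpha> (g w)) = transpose (e p) (e q) (e (\<alpha> (g w)))" by (simp add: g_def)
    also have "\<dots> = transpose (e p) (e q) (g w)" by (simp only: ge)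
    also have "\<dots> = e w" by (simp add: g_def)
    finally show ?thesis .
  qed
  have gp: "g p = e q" "g q = e p" by (auto simp: g_def)
  let ?x = "g(p := q)" and ?y = "g(q := p)"
  have root: "\<omega> x = e" if "x \<star> x = e" for x
    using cyclic_idem_square[of x] cyclic_idem_idem[OF e(2)] that by simp
  have "?x \<star> ?x = e" "?y \<star> ?y = e"
    using \<alpha>pq \<alpha>g gp gg pq by (auto simp: fun_eq_iff mult_apply)
  then have "?x \<in> T" "?y \<in> T" using root iso e(1) by metis+
  then have xy: "?x \<star> ?y \<in> T" by (rule mult)
  \<comment> \<open>Not a trivial update: \<open>p\<close> now goes to itself, so the range gains a
    point that \<open>e\<close> misses.\<close>
  have eq: "?x \<star> ?y = e(p := p)"
    using \<alpha>pq \<alpha>g gp gg pq by (auto simp: fun_eq_iff mult_apply)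
  have idem: "idempotent (e(p := p))"
    using \<alpha>pq by (auto simp: idem_iff efix)
  have "range e \<subseteq> range (e(p := p))"
  proof
    fix b assume "b \<in> range e"
    then have "b = (e(p := p)) (\<alpha> b)"
      using \<alpha>pq(3) efix by (auto simp del: fun_upd_triv)
    then show "b \<in> range (e(p := p))" by (rule range_eqI)
  qed
  moreover have "p \<in> range (e(p := p))" by (rule range_eqI[of _ _ p]) simp
  moreover have "p \<notin> range e" using \<alpha>pq by (metis rangeE)
  ultimately have "range e \<subset> range (e(p := p))" by blast
  then have "r < card (range (e(p := p)))"
    using e(3) psubset_card_mono[of "range (e(p := p))" "range e"] by simp
  moreover have "card (range (e(p := p))) = r"
    using stable_rank_idem[OF idem] layer[OF xy] eq by simp
  ultimately show False by simp
qed

section \<open>Elements of stable rank one below the maximum\<close>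

text \<open>For points \<open>u = a k\<close> and \<open>v = a m\<close>, this says that \<open>x\<close> has trifle element \<open>u\<close> and
  burdened element \<open>v\<close>. It is read off from \<open>x\<close> itself instead of \<open>\<omega> x\<close>.\<close>

definition collapse :: "('n \<Rightarrow> 'n) \<Rightarrow> 'n \<Rightarrow> 'n \<Rightarrow> bool" where
  "collapse x u v \<longleftrightarrow>
     u \<in> A \<and> v \<in> A \<and> u \<noteq> v \<and> \<alpha> (x u) = \<alpha> (x v) \<and> \<alpha> ` x ` A = A - {u}"

lemma collapse_image:
  assumes "collapse x u v"
  shows "\<alpha> ` x ` (A - {u}) = A - {u}" "\<alpha> ` x ` (A - {v}) = A - {u}"
proof -
  have uv: "u \<in> A" "v \<in> A" "u \<noteq> v" "\<alpha> (x u) = \<alpha> (x v)" "\<alpha> ` x ` A = A - {u}"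
    using assms unfolding collapse_def by blast+
  have split: "\<alpha> ` x ` A = insert (\<alpha> (x c)) (\<alpha> ` x ` (A - {c}))" if "c \<in> A" for c
    using that by (metis image_insert insert_Diff)
  have u: "\<alpha> (x u) \<in> \<alpha> ` x ` (A - {u})"
    unfolding uv(4) using uv(2,3) by (intro imageI) simp
  show "\<alpha> ` x ` (A - {u}) = A - {u}"
    by (rule trans[OF sym[OF trans[OF split[OF uv(1)] insert_absorb[OF u]]] uv(5)])
  have v: "\<alpha> (x v) \<in> \<alpha> ` x ` (A - {v})"
    unfolding uv(4)[symmetric] using uv(1,3) by (intro imageI) simp
  show "\<alpha> ` x ` (A - {v}) = A - {u}"
    by (rule trans[OF sym[OF trans[OF split[OF uv(2)] insert_absorb[OF v]]] uv(5)])
qed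

lemma collapse_inj_on:
  assumes "collapse x u v"
  shows "inj_on (\<alpha> \<circ> x) (A - {u})"
proof (rule eq_card_imp_inj_on)
  show "card ((\<alpha> \<circ> x) ` (A - {u})) = card (A - {u})"
    unfolding image_comp[symmetric] collapse_image(1)[OF assms] ..
qed simp

text \<open>Since \<open>\<alpha> \<circ> x\<close> permutes \<open>A - {u}\<close>, any
  identification involves \<open>u\<close>, and \<open>v\<close> is its only possible
  partner.\<close>

lemma collapse_eq_iff:
  assumes x: "collapse x u v" and "c \<in> A" "d \<in> A"
  shows "\<alpha> (x c) = \<alpha> (x d) \<longleftrightarrow> c = d \<or> {c, d} = {u, v}"
proof
  have uv: "u \<in> A" "v \<in> A" "u \<noteq> v" "\<alpha> (x u) = \<alpha> (x v)"
    using x unfolding collapse_def by blast+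
  have inj: "c = d" if "c \<in> A - {u}" "d \<in> A - {u}" "\<alpha> (x c) = \<alpha> (x d)" for c d
    using inj_onD[OF collapse_inj_on[OF x] _ that(1,2)] that(3) by simp
  have at_u: "d = v" if "d \<in> A" "d \<noteq> u" "\<alpha> (x u) = \<alpha> (x d)" for d
    by (rule inj) (use that uv in simp_all)
  show "c = d \<or> {c, d} = {u, v}" if eq: "\<alpha> (x c) = \<alpha> (x d)"
  proof (cases "c = u \<or> d = u")
    case True
    then show ?thesis
      using at_u[OF assms(2)] at_u[OF assms(3)] eq by (metis insert_commute)
  next
    case False
    have "c = d" by (rule inj[OF _ _ eq]) (use False assms(2,3) in simp_all)
    then show ?thesis ..
  qed
  show "\<alpha> (x c) = \<alpha> (x d)" if "c = d \<or> {c, d} = {u, v}"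
    using that uv(4) by (auto simp: doubleton_eq_iff)
qed

lemma collapse_unique:
  assumes "collapse x u v" "collapse x u' v'"
  shows "u = u'" "v = v'"
proof -
  have u: "u \<in> A" "A - {u} = A - {u'}"
    using assms unfolding collapse_def by simp_all
  have v': "v' \<in> A" "u' \<noteq> v'" "\<alpha> (x u') = \<alpha> (x v')"
    using assms(2) unfolding collapse_def by simp_all
  show uu': "u = u'" using u by (metis Diff_iff singletonD singletonI)
  have "u = v' \<or> {u, v'} = {u, v}"
    using collapse_eq_iff[OF assms(1) u(1) v'(1)] v'(3) uu' by simp
  then show "v = v'" using v'(2) uu' by (metis doubleton_eq_iff)
qed

text \<open>The right factor permutes \<open>A - {u}\<close>, the image of the left one, so nothing
  further is merged: the burdened element is that of the left factor.\<close>

lemma collapse_mult: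
  assumes x: "collapse x u v" and y: "collapse y u v'"
  shows "collapse (x \<star> y) u v"
proof -
  have "\<alpha> ` (x \<star> y) ` A = A - {u}"
    using x collapse_image(1)[OF y] unfolding image_mult collapse_def by simp
  then show ?thesis
    using x unfolding collapse_def by (simp add: mult_apply)
qed

text \<open>As \<open>y\<close> identifies \<open>u\<close> and \<open>v\<close>, it is as good on
  \<open>A - {u}\<close> as on \<open>A - {v}\<close>. The product keeps the pair and takes its
  order from the right factor.\<close>

lemma collapse_mult_swap:
  assumes x: "collapse x u v" and y: "collapse y v u"
  shows "collapse (x \<star> y) v u"
proof -
  have "\<alpha> ` (x \<star> y) ` A = A - {v}"
    using x collapse_image(2)[OF y] unfolding image_mult collapse_def by simp
  then show ?thesis
    using x unfolding collapse_def by (auto simp: mult_apply)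
qed

text \<open>Conversely, the image of \<open>x\<close> in \<open>A\<close> contains that of
  \<open>\<omega> x\<close> but cannot be all of \<open>A\<close>, or the stable rank would be full.
  So \<open>x\<close> merges some pair of \<open>A\<close>; \<open>\<omega> x\<close> merges it too,
  and \<open>{u, v}\<close> is the only candidate.\<close>

lemma collapse_cyclic_idem [simp]: "collapse (\<omega> x) u v \<longleftrightarrow> collapse x u v"
proof
  assume "collapse x u v"
  then show "collapse (\<omega> x) u v"
    by (rule cyclic_idem_induct[where P = "\<lambda>y. collapse y u v"])
      (rule collapse_mult[OF _ \<open>collapse x u v\<close>])
next
  assume e: "collapse (\<omega> x) u v"
  then have uv: "u \<in> A" "v \<in> A" "u \<noteq> v" "\<alpha> ` \<omega> x ` A = A - {u}"
    unfolding collapse_def by blast+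
  have "A - {u} \<subseteq> \<alpha> ` x ` A"
    using image_cyclic_idem_subset[of x] uv(4) by simp
  moreover have ne: "\<alpha> ` x ` A \<noteq> A"
    using stable_rank_full_iff[of x] stable_rank_full_iff[of "\<omega> x"] uv(1,4) by auto
  moreover have "\<alpha> ` x ` A \<subseteq> A" by auto
  ultimately have img: "\<alpha> ` x ` A = A - {u}" by blast
  have "\<not> inj_on (\<alpha> \<circ> x) A"
  proof
    assume "inj_on (\<alpha> \<circ> x) A"
    then have "(\<alpha> \<circ> x) ` A = A" by (intro endo_inj_surj) auto
    then show False using ne by (simp add: image_comp)
  qed
  then obtain c d where cd: "c \<in> A" "d \<in> A" "c \<noteq> d" "\<alpha> (x c) = \<alpha> (x d)"
    unfolding inj_on_def by auto
  have "\<omega> x c = \<omega> x d"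
    unfolding kernel_cyclic_idem_iff[of x c d] using cd(4) by simp
  then have "{c, d} = {u, v}"
    using collapse_eq_iff[OF e cd(1,2)] cd(3) by simp
  then have "\<alpha> (x u) = \<alpha> (x v)"
    using cd(4) by (auto simp: doubleton_eq_iff)
  then show "collapse x u v"
    using uv img unfolding collapse_def by blast
qed

lemma collapse_stable_rank:
  assumes "collapse x u v"
  shows "stable_rank \<alpha> x = card A - 1" "1 < card A"
proof -
  have "collapse (\<omega> x) u v" using assms by simp
  then have uv: "u \<in> A" "v \<in> A" "u \<noteq> v" "\<alpha> ` \<omega> x ` A = A - {u}"
    unfolding collapse_def by blast+
  then show "stable_rank \<alpha> x = card A - 1"
    by (simp add: stable_rank_eq)
  have "card {u, v} \<le> card A" using uv by (intro card_mono) auto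
  then show "1 < card A" using uv(3) by simp
qed

text \<open>The idempotent power misses one point \<open>u\<close> of \<open>A\<close> and merges it
  with the \<alpha>-image of its value at \<open>u\<close>. For \<open>card A = 1\<close> the
  assumption is void, because stable ranks are positive.\<close>

lemma ex_collapse:
  assumes "stable_rank \<alpha> x = card A - 1"
  shows "\<exists>u v. collapse x u v"
proof -
  let ?C = "\<alpha> ` \<omega> x ` A"
  have card: "card ?C = card A - 1" "?C \<subseteq> A" "0 < card A"
    using assms stable_rank_eq[of x] by (auto simp: card_gt_0_iff)
  then have "card (A - ?C) = 1" by (subst card_Diff_subset) auto
  then obtain u where "A - ?C = {u}" by (rule card_1_singletonE)
  then have u: "?C = A - {u}" "u \<in> A" using card(2) by blast+
  let ?v = "\<alpha> (\<omega> x u)"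
  have "?v \<in> ?C" using u(2) by simp
  then have v: "?v \<in> A - {u}" using u(1) by simp
  moreover have "\<omega> x ?v = \<omega> x u"
    using idem_cyclic_idem[of x] by (simp add: idem_iff)
  ultimately have "collapse (\<omega> x) u ?v"
    using u unfolding collapse_def by auto
  then show ?thesis by auto
qed

lemma collapse_cyclic_idem_eq_iff:
  assumes "collapse x u v" "c \<in> A" "d \<in> A"
  shows "\<omega> x c = \<omega> x d \<longleftrightarrow> c = d \<or> {c, d} = {u, v}"
proof -
  have "\<omega> x c = \<omega> x d \<longleftrightarrow> \<alpha> (\<omega> x c) = \<alpha> (\<omega> x d)"
    using inj_onD[OF idem_inj_on[OF idem_cyclic_idem[of x]]] by auto
  then show ?thesis
    using collapse_eq_iff[of "\<omega> x" u v c d] assms by simp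
qed

lemma collapse_cyclic_idem_trifle: "collapse x u v \<Longrightarrow> \<omega> x u = \<omega> x v"
  using collapse_cyclic_idem_eq_iff[of x u v u v] by (simp add: collapse_def)

lemma collapse_cyclic_idem_fix:
  assumes "collapse x u v" "c \<in> A" "c \<noteq> u"
  shows "\<alpha> (\<omega> x c) = c"
proof (rule idem_fix_image[OF idem_cyclic_idem])
  have "collapse (\<omega> x) u v" using assms(1) by simp
  then show "c \<in> \<alpha> ` \<omega> x ` A" using assms(2,3) by (simp add: collapse_def)
qed

lemma collapse_range:
  assumes "collapse x u v"
  shows "\<alpha> ` range (\<omega> x) = A - {u}"
proof -
  have "collapse (\<omega> x) u v" using assms by simp
  then show ?thesis
    using idem_range[OF idem_cyclic_idem[of x]] by (simp add: collapse_def)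
qed

text \<open>On \<open>A\<close> the kernel sees only the unordered pair, so trifle and burdened
  elements may be exchanged between the factors. The range sees the trifle element, which is why
  \<open>collapse_range_mult\<close> asks for a common \<open>u\<close>.\<close>

lemma collapse_kernel_mult:
  assumes x: "collapse x u v" and y: "collapse y u' v'"
    and xy: "collapse (x \<star> y) u'' v''" and "{u', v'} = {u, v}" "{u'', v''} = {u, v}"
  shows "map_kernel (\<omega> (x \<star> y)) = map_kernel (\<omega> x)"
  using collapse_cyclic_idem_eq_iff[OF x] collapse_cyclic_idem_eq_iff[OF y]
    collapse_cyclic_idem_eq_iff[OF xy] assms(4,5)
  by (intro map_kernel_cyclic_idem_mult) auto

lemma collapse_range_mult:
  assumes x: "collapse x u v" and y: "collapse y u v'"
  shows "range (\<omega> (x \<star> y)) = range (\<omega> y)"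
  using collapse_range[OF x] collapse_range[OF y] collapse_range[OF collapse_mult[OF x y]]
  by (intro range_cyclic_idem_mult) auto

lemma full_kernel_mult:
  assumes "stable_rank \<alpha> x = card A" "stable_rank \<alpha> y = card A"
  shows "map_kernel (\<omega> (x \<star> y)) = map_kernel (\<omega> x)"
proof (rule map_kernel_cyclic_idem_mult)
  have fix_inj: "\<omega> z c = \<omega> z d \<longleftrightarrow> c = d"
    if "stable_rank \<alpha> z = card A" "c \<in> A" "d \<in> A" for z c d
    using idem_full_fix[OF that(1,2)] idem_full_fix[OF that(1,3)] by metis
  have "stable_rank \<alpha> (x \<star> y) = card A"
    using assms stable_rank_mult_full_iff by simp
  then show "\<omega> x c = \<omega> x d \<longleftrightarrow> \<omega> y c = \<omega> y d" "\<omega> y c = \<omega> y d \<longleftrightarrow> \<omega> (x \<star> y) c = \<omega> (x \<star> y) d"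
    if "c \<in> A" "d \<in> A" for c d
    using fix_inj that assms by simp_all
qed

lemma full_range:
  assumes "stable_rank \<alpha> x = card A"
  shows "\<alpha> ` range (\<omega> x) = A"
proof -
  have "\<alpha> ` \<omega> x ` A = A"
    using assms stable_rank_full_iff[of "\<omega> x"] by simp
  then show ?thesis
    using idem_range[OF idem_cyclic_idem[of x]] by simp
qed

lemma full_range_mult:
  assumes "stable_rank \<alpha> x = card A" "stable_rank \<alpha> y = card A"
  shows "range (\<omega> (x \<star> y)) = range (\<omega> y)"
proof -
  have "stable_rank \<alpha> (x \<star> y) = card A"
    using assms stable_rank_mult_full_iff by simp
  then show ?thesis
    using assms full_range by (intro range_cyclic_idem_mult) simp_all
qed

text \<open>The idempotent sends \<open>z\<close> to the one \<open>b\<close> in \<open>B\<close>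
  whose \<alpha>-image lies in the block of \<open>z\<close>.\<close>

lemma ex_idem_kernel_range:
  assumes P: "partition_on UNIV P" and B: "inj_on \<alpha> B"
    and ex1: "\<And>p. p \<in> P \<Longrightarrow> \<exists>!c. c \<in> p \<and> c \<in> \<alpha> ` B"
  shows "\<exists>e. idempotent e \<and> map_kernel e = P \<and> range e = B"
proof -
  have "\<exists>b p. b \<in> B \<and> p \<in> P \<and> z \<in> p \<and> \<alpha> b \<in> p" for z
  proof -
    obtain p where "p \<in> P" "z \<in> p"
      using partition_onD1[OF P] by blast
    then show ?thesis using ex1[of p] by blast
  qed
  then obtain e p where e: "e z \<in> B" "p z \<in> P" "z \<in> p z" "\<alpha> (e z) \<in> p z" for z
    by metis
  have same_block: "q = q'" if "q \<in> P" "q' \<in> P" "w \<in> q" "w \<in> q'" for q q' w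
    using partition_onD2[OF P] that unfolding disjoint_def by blast
  have e_unique: "e z = b" if "b \<in> B" "\<alpha> b \<in> p z" for z b
    using ex1[OF e(2)[of z]] e(1,4)[of z] that inj_onD[OF B] by blast
  have e_eq_iff: "e z = e z' \<longleftrightarrow> z' \<in> p z" for z z'
  proof
    show "z' \<in> p z" if "e z = e z'"
      using same_block[OF e(2)[of z] e(2)[of z'], of "\<alpha> (e z)"] e(3)[of z'] e(4)[of z] e(4)[of z'] that
      by simp
    show "e z = e z'" if "z' \<in> p z"
      using same_block[OF e(2)[of z] e(2)[of z'], of z'] e(3)[of z'] e_unique[OF e(1)[of z'], of z]
        e(4)[of z'] that
      by simp
  qed
  have "e (\<alpha> (e z)) = e z" for z
    using e_eq_iff[of z "\<alpha> (e z)"] e(4)[of z] by simp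
  then have "idempotent e" by (simp add: idem_iff)
  moreover have "range e = B"
    using e(1) e_unique e(3) by (metis rangeI subsetI subset_antisym image_subset_iff)
  moreover have "map_kernel e = P"
  proof -
    have "map_kernel e = range p"
      unfolding map_kernel_eq e_eq_iff by simp
    also have "\<dots> = P"
    proof
      show "P \<subseteq> range p"
      proof
        fix q assume q: "q \<in> P"
        then obtain w where "w \<in> q" using partition_onD3[OF P] by (metis ex_in_conv)
        then have "q = p w" using same_block q e(2,3) by metis
        then show "q \<in> range p" by blast
      qed
    qed (use e(2) in auto)
    finally show ?thesis .
  qed
  ultimately show ?thesis by blast
qed

section \<open>The families of isolated subsemigroups\<close>

abbreviation stable_kernel where "stable_kernel x \<equiv> map_kernel (\<omega> x)"

abbreviation stable_range where "stable_range x \<equiv> range (\<omega> x)"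

definition full_family where
  "full_family X Y =
     {x. stable_rank \<alpha> x = card A \<and> stable_kernel x \<in> X \<and> stable_range x \<in> Y}"

text \<open>One shape for three families: \<open>R\<close> is a single pair for \<open>H\<close>, a
  pair in both orders for \<open>K\<close>, and \<open>{u} \<times> M\<close> for \<open>L\<close>;
  \<open>UNIV\<close> stands for an unrestricted kernel or range.\<close>

definition collapse_family where
  "collapse_family R X Y =
     {x. (\<exists>(u, v)\<in>R. collapse x u v) \<and> stable_kernel x \<in> X \<and> stable_range x \<in> Y}"

lemma mem_collapse_family:
  "x \<in> collapse_family R X Y \<longleftrightarrow>
     (\<exists>u v. (u, v) \<in> R \<and> collapse x u v) \<and> stable_kernel x \<in> X \<and> stable_range x \<in> Y"
  by (auto simp: collapse_family_def)

lemma isolatedI: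
  assumes "T \<noteq> {}" "\<And>x y. x \<in> T \<Longrightarrow> y \<in> T \<Longrightarrow> x \<star> y \<in> T" "\<And>x. \<omega> x \<in> T \<longleftrightarrow> x \<in> T"
  shows "isolated_subsemigroup (variant \<alpha>) T"
  using assms by (simp add: isolated_subsemigroup_iff subsemigroup_def)

lemma isolated_memI:
  assumes T: "isolated_subsemigroup (variant \<alpha>) T"
    and "s \<in> T" "stable_kernel s = stable_kernel x" "stable_range s = stable_range x"
  shows "x \<in> T"
proof -
  have "\<omega> s = \<omega> x"
    by (intro idem_eqI idem_cyclic_idem assms(3,4))
  then show ?thesis
    using assms(2) isolated_cyclic_idem[OF T] by metis
qed

lemma isolated_full_family:
  assumes "full_family X Y \<noteq> {}"
  shows "isolated_subsemigroup (variant \<alpha>) (full_family X Y)"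
  using assms
proof (rule isolatedI)
  show "x \<star> y \<in> full_family X Y" if "x \<in> full_family X Y" "y \<in> full_family X Y" for x y
    using that by (simp add: full_family_def stable_rank_mult_full_iff full_kernel_mult full_range_mult)
qed (simp add: full_family_def)

lemma isolated_collapse_family_singleton:
  assumes "collapse_family {(u, v)} X Y \<noteq> {}"
  shows "isolated_subsemigroup (variant \<alpha>) (collapse_family {(u, v)} X Y)"
  using assms
proof (rule isolatedI)
  show "x \<star> y \<in> collapse_family {(u, v)} X Y"
    if "x \<in> collapse_family {(u, v)} X Y" "y \<in> collapse_family {(u, v)} X Y" for x y
  proof -
    have x: "collapse x u v" "stable_kernel x \<in> X" and y: "collapse y u v" "stable_range y \<in> Y"
      using that by (auto simp: collapse_family_def)
    have xy: "collapse (x \<star> y) u v" using collapse_mult x(1) y(1) by blast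
    have "stable_kernel (x \<star> y) = stable_kernel x"
      by (rule collapse_kernel_mult[OF x(1) y(1) xy]) simp_all
    moreover have "stable_range (x \<star> y) = stable_range y"
      by (rule collapse_range_mult[OF x(1) y(1)])
    ultimately show ?thesis using x y xy by (simp add: collapse_family_def)
  qed
qed (simp add: collapse_family_def)

lemma isolated_collapse_family_swap:
  assumes "collapse_family {(u, v), (v, u)} X UNIV \<noteq> {}"
  shows "isolated_subsemigroup (variant \<alpha>) (collapse_family {(u, v), (v, u)} X UNIV)"
  using assms
proof (rule isolatedI)
  show "x \<star> y \<in> collapse_family {(u, v), (v, u)} X UNIV"
    if xy: "x \<in> collapse_family {(u, v), (v, u)} X UNIV" "y \<in> collapse_family {(u, v), (v, u)} X UNIV"
    for x y
  proof -
    obtain u1 v1 where x: "collapse x u1 v1" "{u1, v1} = {u, v}" "stable_kernel x \<in> X"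
      using xy(1) unfolding mem_collapse_family by blast
    obtain u2 v2 where y: "collapse y u2 v2" "{u2, v2} = {u, v}"
      using xy(2) unfolding mem_collapse_family by blast
    have x_y: "collapse (x \<star> y) u2 v2"
      using collapse_mult[of x u1 v1 y v2] collapse_mult_swap[of x u1 v1 y] x y
      by (auto simp: doubleton_eq_iff)
    moreover have "stable_kernel (x \<star> y) = stable_kernel x"
      using x(2) y(2) by (intro collapse_kernel_mult[OF x(1) y(1) x_y]) simp_all
    moreover have "(u2, v2) \<in> {(u, v), (v, u)}"
      using y(2) by (auto simp: doubleton_eq_iff)
    ultimately show ?thesis using x(3) by (auto simp: mem_collapse_family)
  qed
qed (simp add: collapse_family_def)

lemma isolated_collapse_family_times:
  assumes "collapse_family ({u} \<times> M) UNIV Y \<noteq> {}"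
  shows "isolated_subsemigroup (variant \<alpha>) (collapse_family ({u} \<times> M) UNIV Y)"
  using assms
proof (rule isolatedI)
  show "x \<star> y \<in> collapse_family ({u} \<times> M) UNIV Y"
    if xy: "x \<in> collapse_family ({u} \<times> M) UNIV Y" "y \<in> collapse_family ({u} \<times> M) UNIV Y" for x y
  proof -
    obtain v where x: "collapse x u v" "v \<in> M"
      using xy(1) unfolding mem_collapse_family by blast
    obtain v' where y: "collapse y u v'" "stable_range y \<in> Y"
      using xy(2) unfolding mem_collapse_family by blast
    show ?thesis
      using x(2) y(2) collapse_mult[OF x(1) y(1)] collapse_range_mult[OF x(1) y(1)]
      by (auto simp: collapse_family_def)
  qed
qed (simp add: collapse_family_def)

lemma const_low: "1 < card A \<Longrightarrow> stable_rank \<alpha> (\<lambda>_. b) = 1"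
  using stable_rank_idem[of "\<lambda>_. b"] by (simp add: idem_iff)

lemma isolated_low:
  assumes "1 < card A"
  shows "isolated_subsemigroup (variant \<alpha>) {x. stable_rank \<alpha> x < card A}"
proof (rule isolatedI)
  show "{x. stable_rank \<alpha> x < card A} \<noteq> {}"
    using const_low[OF assms] assms by (metis (mono_tags) empty_Collect_eq)
  show "x \<star> y \<in> {x. stable_rank \<alpha> x < card A}"
    if "x \<in> {x. stable_rank \<alpha> x < card A}" for x y
    using that stable_rank_mult_full_iff[of x y] stable_rank_le[of "x \<star> y"] by simp
qed simp

lemma isolated_full_family_low:
  assumes "1 < card A" and ne: "full_family X Y \<noteq> {}"
  shows "isolated_subsemigroup (variant \<alpha>) (full_family X Y \<union> {x. stable_rank \<alpha> x < card A})"
proof (rule isolatedI)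
  let ?T = "full_family X Y \<union> {x. stable_rank \<alpha> x < card A}"
  show "?T \<noteq> {}" using ne by blast
  show "\<omega> x \<in> ?T \<longleftrightarrow> x \<in> ?T" for x
    by (simp add: full_family_def)
  show "x \<star> y \<in> ?T" if "x \<in> ?T" "y \<in> ?T" for x y
  proof (cases "x \<in> full_family X Y \<and> y \<in> full_family X Y")
    case True
    then show ?thesis
      using isolated_mult[OF isolated_full_family[OF ne]] by blast
  next
    case False
    then have "stable_rank \<alpha> x < card A \<or> stable_rank \<alpha> y < card A"
      using that by blast
    then show ?thesis
      using stable_rank_mult_full_iff[of x y] stable_rank_le[of "x \<star> y"] by auto
  qed
qed

section \<open>Classification by stable ranks\<close>

lemma isolated_full_eq:
  assumes T: "isolated_subsemigroup (variant \<alpha>) T"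
    and full: "\<And>x. x \<in> T \<Longrightarrow> stable_rank \<alpha> x = card A"
  shows "T = full_family (stable_kernel ` T) (stable_range ` T)"
proof
  show "full_family (stable_kernel ` T) (stable_range ` T) \<subseteq> T"
  proof
    fix x assume "x \<in> full_family (stable_kernel ` T) (stable_range ` T)"
    then obtain s t where st: "s \<in> T" "t \<in> T" "stable_kernel x = stable_kernel s"
      "stable_range x = stable_range t"
      by (auto simp: full_family_def)
    show "x \<in> T"
    proof (rule isolated_memI[OF T])
      show "s \<star> t \<in> T" using isolated_mult[OF T] st by blast
      show "stable_kernel (s \<star> t) = stable_kernel x" "stable_range (s \<star> t) = stable_range x"
        using st full full_kernel_mult full_range_mult by simp_all
    qed
  qed
qed (use full in \<open>auto simp: full_family_def\<close>)

lemma isolated_singleton_eq: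
  assumes T: "isolated_subsemigroup (variant \<alpha>) T"
    and uv: "\<And>x. x \<in> T \<Longrightarrow> collapse x u v"
  shows "T = collapse_family {(u, v)} (stable_kernel ` T) (stable_range ` T)"
proof
  show "collapse_family {(u, v)} (stable_kernel ` T) (stable_range ` T) \<subseteq> T"
  proof
    fix x assume "x \<in> collapse_family {(u, v)} (stable_kernel ` T) (stable_range ` T)"
    then obtain s t where st: "s \<in> T" "t \<in> T" "stable_kernel x = stable_kernel s"
      "stable_range x = stable_range t"
      by (auto simp: collapse_family_def)
    show "x \<in> T"
    proof (rule isolated_memI[OF T])
      show st_T: "s \<star> t \<in> T" using isolated_mult[OF T] st by blast
      show "stable_kernel (s \<star> t) = stable_kernel x"
        using collapse_kernel_mult[OF uv[OF st(1)] uv[OF st(2)] uv[OF st_T]] st by simp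
      show "stable_range (s \<star> t) = stable_range x"
        using collapse_range_mult[OF uv[OF st(1)] uv[OF st(2)]] st by simp
    qed
  qed
qed (use uv in \<open>auto simp: collapse_family_def\<close>)

text \<open>Two idempotents with different burdened elements have roots that pass through the trifle
  element; their product moves a single point outside \<open>A\<close> to another kernel class.\<close>

lemma fun_upd_in_isolated:
  assumes T: "isolated_subsemigroup (variant \<alpha>) T"
    and e: "e \<in> T" "idempotent e" "collapse e u v"
    and f: "f \<in> T" "idempotent f" "collapse f u v'"
    and "v \<noteq> v'" "range f = range e" "z \<notin> A" "b \<in> range e"
  shows "e(z := b) \<in> T"
proof (cases "b = e z")
  case False
  have ef: "\<omega> e = e" "\<omega> f = f" using e f cyclic_idem_idem by auto
  have uv: "u \<in> A" "v \<in> A" "v \<noteq> u" "v' \<in> A" "v' \<noteq> u"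
    using e(3) f(3) by (auto simp: collapse_def)
  have "\<alpha> (e v) = v" "\<alpha> (f v') = v'" "e u = e v" "f u = f v'"
    using collapse_cyclic_idem_fix[of e u v v] collapse_cyclic_idem_fix[of f u v' v']
      collapse_cyclic_idem_trifle[of e u v] collapse_cyclic_idem_trifle[of f u v'] e f ef uv
    by simp_all
  then have b: "e u \<noteq> f u" using \<open>v \<noteq> v'\<close> by metis
  have fu: "f u \<in> range e" using \<open>range f = range e\<close> by auto
  \<comment> \<open>The root \<open>?x\<close> will send \<open>z\<close> to \<open>u\<close>, so
    its square at \<open>z\<close> is \<open>\<pi> (e u)\<close>; this fits
    \<open>\<pi> \<circ> \<pi> \<circ> e\<close> exactly if \<open>\<pi> (e z) = e u\<close>. In the
    product with \<open>?y\<close> the point \<open>z\<close> gets the inverse image of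
    \<open>f u\<close> under \<open>\<pi>\<close>, which has to be \<open>b\<close>. Both demands
    are compatible because different burdened elements give \<open>e u \<noteq> f u\<close>.\<close>
  obtain \<pi> where \<pi>: "bij_betw \<pi> (range e) (range e)" "\<pi> (e z) = e u" "\<pi> b = f u"
    by (rule ex_move_pair[of "e z" "range e" b "e u" "f u"])
      (use False \<open>b \<in> range e\<close> fu b in auto)
  have e_fix: "e (\<alpha> c) = c" "f (\<alpha> c) = c" if "c \<in> range e" for c
    using that e(2) f(2) idem_fix \<open>range f = range e\<close> by simp_all
  have \<pi>_in: "\<pi> (e w) \<in> range e" for w
    using bij_betwE[OF \<pi>(1)] by simp
  have z: "\<alpha> w \<noteq> z" "z \<noteq> u" for w
    using \<open>z \<notin> A\<close> uv(1) alpha_in_A[of w] by metis+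
  let ?x = "(\<pi> \<circ> e)(z := u)" and ?y = "inv_into (range e) \<pi> \<circ> f"
  have "?x \<star> ?x = (\<pi> \<circ> \<pi>) \<circ> e"
    using z \<pi> e_fix(1)[OF \<pi>_in] uv(1) by (auto simp: fun_eq_iff mult_apply)
  moreover have "bij_betw (\<pi> \<circ> \<pi>) (range e) (range e)"
    using \<pi>(1) bij_betw_trans by blast
  ultimately have "\<omega> ?x = e"
    by (intro cyclic_idem_eq_if_square[OF e(2)]) (auto simp: bij_betw_def)
  then have x: "?x \<in> T" using isolated_cyclic_idem[OF T] e(1) by metis
  have "\<omega> ?y = f"
    using f(2) bij_betw_inv_into[OF \<pi>(1)] \<open>range f = range e\<close>
    by (intro cyclic_idem_comp_perm) simp_all
  then have y: "?y \<in> T" using isolated_cyclic_idem[OF T] f(1) by metis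
  have inv: "inv_into (range e) \<pi> (\<pi> c) = c" if "c \<in> range e" for c
    using bij_betw_inv_into_left[OF \<pi>(1) that] .
  have "?x \<star> ?y = e(z := b)"
    using z uv(1) e_fix(2)[OF \<pi>_in] inv inv[OF \<open>b \<in> range e\<close>] \<pi>(3)
    by (auto simp: fun_eq_iff mult_apply)
  then show ?thesis using isolated_mult[OF T x y] by simp
qed (use e in simp)

text \<open>Induction on the number of points where \<open>e\<close> and \<open>g\<close> differ,
  correcting one per step. The idempotent \<open>f\<close> with the other burdened element serves
  unchanged in every step.\<close>

lemma isolated_kernel_change:
  assumes T: "isolated_subsemigroup (variant \<alpha>) T"
    and f: "f \<in> T" "idempotent f" "collapse f u v'" "v \<noteq> v'" "range f = range g"
    and g: "idempotent g" "collapse g u v"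
    and e: "e \<in> T" "idempotent e" "collapse e u v" "range e = range g"
  shows "g \<in> T"
  using e
proof (induction "card {z. e z \<noteq> g z}" arbitrary: e rule: less_induct)
  case less
  show ?case
  proof (cases "{z. e z \<noteq> g z} = {}")
    case True
    then have "e = g" by auto
    then show ?thesis using less.prems by simp
  next
    case False
    then obtain z where z: "e z \<noteq> g z" by blast
    have eg: "\<omega> e = e" "\<omega> g = g" using less.prems g cyclic_idem_idem by auto
    have uv: "u \<in> A" "v \<in> A" "v \<noteq> u"
      using g(2) by (auto simp: collapse_def)
    \<comment> \<open>Both send \<open>c\<close> to the only point of the common range whose
      \<alpha>-image is \<open>c\<close>, so disagreements are confined to points outside
      \<open>A\<close>.\<close>
    have off_u: "e c = g c" if "c \<in> A" "c \<noteq> u" for c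
    proof -
      have "\<alpha> (e c) = c" "\<alpha> (g c) = c"
        using collapse_cyclic_idem_fix[of e u v c] collapse_cyclic_idem_fix[of g u v c]
          less.prems g eg that by simp_all
      moreover have "e c \<in> range g" using less.prems(4) by blast
      ultimately show ?thesis using idem_fix[OF g(1), of "e c"] by simp
    qed
    have "e u = g u"
      using collapse_cyclic_idem_trifle[of e u v] collapse_cyclic_idem_trifle[of g u v]
        less.prems g eg off_u[OF uv(2,3)] by simp
    then have zA: "z \<notin> A" using off_u z by metis
    have \<alpha>z: "\<alpha> w \<noteq> z" for w using zA alpha_in_A[of w] by metis
    have gz: "g z \<in> range e" using less.prems(4) by blast
    let ?e = "e(z := g z)"
    have e_fix: "e (\<alpha> c) = c" if "c \<in> range e" for c
      using that less.prems(2) idem_fix by simp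
    show ?thesis
    proof (rule less.hyps)
      have "{w. ?e w \<noteq> g w} \<subset> {w. e w \<noteq> g w}" using z by auto
      then show "card {w. ?e w \<noteq> g w} < card {w. e w \<noteq> g w}"
        by (intro psubset_card_mono) simp_all
      show "?e \<in> T"
        by (rule fun_upd_in_isolated[OF T less.prems(1-3) f(1-4)])
          (use f(5) less.prems(4) zA gz in simp_all)
      show "idempotent ?e"
        using \<alpha>z e_fix gz by (auto simp: idem_iff)
      have "?e ` A = e ` A" by (rule image_cong) (use zA in auto)
      then show "collapse ?e u v"
        using less.prems(3) zA uv by (auto simp: collapse_def)
      have "range e \<subseteq> range ?e"
      proof
        fix c assume "c \<in> range e"
        then have "c = ?e (\<alpha> c)" using e_fix \<alpha>z by simp
        then show "c \<in> range ?e" by (rule range_eqI)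
      qed
      moreover have "range ?e \<subseteq> range e" using gz by auto
      ultimately show "range ?e = range g" using less.prems(4) by (metis subset_antisym)
    qed
  qed
qed

lemma isolated_times_eq:
  assumes T: "isolated_subsemigroup (variant \<alpha>) T"
    and u: "\<And>x. x \<in> T \<Longrightarrow> \<exists>v. collapse x u v"
    and vv: "x1 \<in> T" "collapse x1 u v1" "x2 \<in> T" "collapse x2 u v2" "v1 \<noteq> v2"
  shows "T = collapse_family ({u} \<times> {v. \<exists>x\<in>T. collapse x u v}) UNIV (stable_range ` T)"
    (is "T = ?F")
proof
  show "T \<subseteq> ?F" using u unfolding subset_iff mem_collapse_family by blast
  show "?F \<subseteq> T"
  proof
    fix x assume "x \<in> ?F"
    then obtain v s t where x: "collapse x u v" "s \<in> T" "collapse s u v" "t \<in> T"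
      "stable_range x = stable_range t"
      by (auto simp: collapse_family_def)
    obtain w where t: "collapse t u w" using u x(4) by blast
    obtain s' v' where s': "s' \<in> T" "collapse s' u v'" "v \<noteq> v'"
      using vv by metis
    \<comment> \<open>The right factor \<open>t\<close> gives both products the range of
      \<open>x\<close>; the left factors \<open>s\<close> and \<open>s'\<close> supply the wanted
      burdened element and a different one.\<close>
    have "\<omega> x \<in> T"
    proof (rule isolated_kernel_change[OF T])
      show "\<omega> (s' \<star> t) \<in> T" "\<omega> (s \<star> t) \<in> T"
        using isolated_cyclic_idem[OF T] isolated_mult[OF T] s'(1) x(2,4) by simp_all
      show "collapse (\<omega> (s' \<star> t)) u v'" "collapse (\<omega> (s \<star> t)) u v" "collapse (\<omega> x) u v"
        using collapse_mult[OF s'(2) t] collapse_mult[OF x(3) t] x(1) by simp_all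
      show "range (\<omega> (s' \<star> t)) = range (\<omega> x)" "range (\<omega> (s \<star> t)) = range (\<omega> x)"
        using collapse_range_mult[OF s'(2) t] collapse_range_mult[OF x(3) t] x(5) by simp_all
    qed (use s'(3) idem_cyclic_idem in simp_all)
    then show "x \<in> T" using isolated_cyclic_idem[OF T] by simp
  qed
qed

text \<open>A root of \<open>\<omega> t\<close> may send the trifle element \<open>u\<close> to any point of the block it permutes
  to; multiplying by \<open>s\<close>, whose image contains \<open>u\<close> up to \<open>\<alpha>\<close>, makes this point visible.\<close>

lemma range_exchange:
  assumes T: "isolated_subsemigroup (variant \<alpha>) T"
    and t: "t \<in> T" "collapse t u v" and s: "s \<in> T" "collapse s v u"
    and b: "b \<in> stable_range t" "\<alpha> b' = \<alpha> b"
  shows "\<exists>t'\<in>T. collapse t' u v \<and> stable_range t' = insert b' (stable_range t - {b})"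
proof -
  define e f where "e = \<omega> t" and "f = \<omega> s"
  have e: "e \<in> T" "idempotent e" and f: "f \<in> T" "idempotent f"
    using isolated_cyclic_idem[OF T] t(1) s(1) idem_cyclic_idem by (simp_all add: e_def f_def)
  have uv: "u \<in> A" "v \<in> A" "v \<noteq> u"
    using t(2) by (auto simp: collapse_def)
  have \<alpha>e: "\<alpha> (e c) = c" if "c \<in> A" "c \<noteq> u" for c
    using collapse_cyclic_idem_fix[OF t(2) that] by (simp add: e_def)
  have eu: "e u = e v"
    using collapse_cyclic_idem_trifle[OF t(2)] by (simp add: e_def)
  have \<alpha>_range: "\<alpha> ` range e = A - {u}" "\<alpha> ` range f = A - {v}"
    using collapse_range[OF t(2)] collapse_range[OF s(2)] by (simp_all add: e_def f_def)
  have e_fix: "e (\<alpha> c) = c" if "c \<in> range e" for c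
    using that e(2) idem_fix by simp
  have b_in: "b \<in> range e" using b(1) by (simp add: e_def)
  have \<alpha>_not_u: "\<alpha> c \<noteq> u" if "c \<in> range e" for c
    using that \<alpha>_range(1) by blast
  \<comment> \<open>Arranged so that \<open>u\<close> and \<open>v\<close> would both go to
    \<open>b\<close>. Redirecting \<open>u\<close> to \<open>b'\<close> is invisible in the square,
    as \<open>b\<close> and \<open>b'\<close> agree under \<alpha>. After \<open>f\<close>, which
    misses \<open>v\<close> but not \<open>u\<close>, the value \<open>b'\<close> appears and
    \<open>b\<close> is no longer attained unless \<open>b' = b\<close>.\<close>
  let ?\<pi> = "transpose (e v) b"
  have \<pi>: "bij_betw ?\<pi> (range e) (range e)"
    using b_in by (intro bij_betw_byWitness[where f' = ?\<pi>]) (auto simp: transpose_def)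
  have \<pi>_in: "?\<pi> (e w) \<in> range e" for w
    using bij_betwE[OF \<pi>] by simp
  let ?x = "(?\<pi> \<circ> e)(u := b')"
  have "?x \<star> ?x = (?\<pi> \<circ> ?\<pi>) \<circ> e"
    using \<alpha>_not_u[OF \<pi>_in] e_fix[OF \<pi>_in] \<alpha>_not_u[OF b_in] e_fix[OF b_in] b(2) eu
    by (auto simp: fun_eq_iff mult_apply)
  then have \<omega>x: "\<omega> ?x = e"
    by (intro cyclic_idem_eq_if_square[OF e(2)]) auto
  then have x: "?x \<in> T" using isolated_cyclic_idem[OF T] e(1) by metis
  have "collapse (\<omega> ?x) u v" unfolding \<omega>x using t(2) by (simp add: e_def)
  then have x_uv: "collapse ?x u v" by simp
  have "collapse f v u" using s(2) by (simp add: f_def)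
  then have w_uv: "collapse (f \<star> ?x) u v" by (rule collapse_mult_swap) (rule x_uv)
  have e_off: "e ` (A - {v, u}) = range e - {e v}"
  proof
    show "e ` (A - {v, u}) \<subseteq> range e - {e v}"
      using \<alpha>e uv by (auto, metis)
    show "range e - {e v} \<subseteq> e ` (A - {v, u})"
      using eu by (auto simp: idem_range[OF e(2), symmetric])
  qed
  have "range (f \<star> ?x) = ?x ` \<alpha> ` range f"
    by (auto simp: mult_apply image_image)
  also have "\<dots> = insert b' (?x ` (A - {v, u}))"
  proof -
    have "A - {v} = insert u (A - {v, u})" using uv by auto
    then show ?thesis unfolding \<alpha>_range(2) by (simp only: image_insert fun_upd_same)
  qed
  also have "?x ` (A - {v, u}) = ?\<pi> ` e ` (A - {v, u})"
    by (auto simp: image_image)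
  also have "\<dots> = range e - {b}"
    unfolding e_off using \<pi> by (simp add: inj_on_image_set_diff[of ?\<pi> UNIV] bij_betw_def)
  finally have range_w: "range (f \<star> ?x) = insert b' (range e - {b})" .
  \<comment> \<open>The range of the product has no more points than its stable rank, so the
    idempotent power loses none of them.\<close>
  have "card (insert b' (range e - {b})) \<le> card (range e)"
    using b_in card_insert_le_m1[of "card (range e)" "range e - {b}" b'] by (simp add: card_gt_0_iff)
  moreover have "card (range e) = card (stable_range (f \<star> ?x))"
    using collapse_stable_rank(1)[OF w_uv] collapse_stable_rank(1)[OF t(2)]
    by (simp add: stable_rank_def map_rank_def e_def)
  ultimately have "stable_range (f \<star> ?x) = insert b' (range e - {b})"
    using range_cyclic_idem_subset[of "f \<star> ?x"] range_w by (intro card_seteq) simp_all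
  then show ?thesis
    using isolated_mult[OF T f(1) x] w_uv by (auto simp: e_def)
qed

text \<open>\<open>B\<close> and the current range are transversals of the same blocks, so a point
  of \<open>B\<close> not yet attained has a partner to be exchanged for; each exchange brings the
  range one point closer to \<open>B\<close>.\<close>

lemma range_change:
  assumes T: "isolated_subsemigroup (variant \<alpha>) T"
    and s: "s \<in> T" "collapse s v u"
    and B: "inj_on \<alpha> B" "\<alpha> ` B = A - {u}"
    and t: "t \<in> T" "collapse t u v"
  shows "\<exists>t'\<in>T. collapse t' u v \<and> stable_range t' = B"
  using t
proof (induction "card (B - stable_range t)" arbitrary: t rule: less_induct)
  case less
  let ?C = "stable_range t"
  have C: "inj_on \<alpha> ?C" "\<alpha> ` ?C = A - {u}"
    using idem_inj_on[OF idem_cyclic_idem] collapse_range[OF less.prems(2)] by blast+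
  show ?case
  proof (cases "B \<subseteq> ?C")
    case True
    moreover have "card B = card ?C"
      using B C card_image by metis
    ultimately have "B = ?C" by (intro card_subset_eq) simp_all
    then show ?thesis using less.prems by blast
  next
    case False
    then obtain b' where b': "b' \<in> B" "b' \<notin> ?C" by blast
    then have "\<alpha> b' \<in> \<alpha> ` ?C" using B C by blast
    then obtain b where b: "b \<in> ?C" "\<alpha> b' = \<alpha> b" by blast
    have "b \<notin> B" using b b' inj_onD[OF B(1)] by metis
    obtain t' where t': "t' \<in> T" "collapse t' u v" "stable_range t' = insert b' (?C - {b})"
      using range_exchange[OF T less.prems s b] by blast
    have "B - stable_range t' \<subset> B - ?C"
      using t'(3) b' \<open>b \<notin> B\<close> by auto
    then have "card (B - stable_range t') < card (B - ?C)"
      by (intro psubset_card_mono) simp_all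
    then show ?thesis using less.hyps t' by blast
  qed
qed

lemma isolated_swap_subset:
  assumes T: "isolated_subsemigroup (variant \<alpha>) T"
    and pairs: "\<And>x. x \<in> T \<Longrightarrow> collapse x u v \<or> collapse x v u"
    and t: "t \<in> T" "collapse t u v" and s: "s \<in> T" "collapse s v u"
    and x: "collapse x u v" "stable_kernel x \<in> stable_kernel ` T"
  shows "x \<in> T"
proof -
  obtain r where r: "r \<in> T" "stable_kernel x = stable_kernel r" using x(2) by blast
  obtain t' where t': "t' \<in> T" "collapse t' u v" "stable_range t' = stable_range x"
    using range_change[OF T s idem_inj_on[OF idem_cyclic_idem] collapse_range[OF x(1)] t] by blast
  have r': "collapse (r \<star> t') u v" "stable_kernel (r \<star> t') = stable_kernel r"
  proof -
    consider "collapse r u v" | "collapse r v u" using pairs r(1) by blast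
    then show "collapse (r \<star> t') u v" "stable_kernel (r \<star> t') = stable_kernel r"
      using collapse_mult[OF _ t'(2)] collapse_mult_swap[OF _ t'(2)]
        collapse_kernel_mult[OF _ t'(2)] by (cases; blast)+
  qed
  have rt: "r \<star> t' \<in> T" using isolated_mult[OF T] r t' by blast
  \<comment> \<open>One factor \<open>t'\<close> only brings the pair into the order
    \<open>(u, v)\<close>; if \<open>r\<close> has the opposite order,
    \<open>collapse_range_mult\<close> does not apply yet. The second factor then meets the same
    trifle element and imposes its range.\<close>
  have rtt: "collapse (r \<star> t' \<star> t') u v" by (rule collapse_mult[OF r'(1) t'(2)])
  show ?thesis
  proof (rule isolated_memI[OF T])
    show "r \<star> t' \<star> t' \<in> T" using isolated_mult[OF T] rt t' by blast
    show "stable_kernel (r \<star> t' \<star> t') = stable_kernel x"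
      using collapse_kernel_mult[OF r'(1) t'(2) rtt] r'(2) r(2) by simp
    show "stable_range (r \<star> t' \<star> t') = stable_range x"
      using collapse_range_mult[OF r'(1) t'(2)] t'(3) by simp
  qed
qed

lemma isolated_swap_eq:
  assumes T: "isolated_subsemigroup (variant \<alpha>) T"
    and pairs: "\<And>x. x \<in> T \<Longrightarrow> collapse x u v \<or> collapse x v u"
    and t: "t \<in> T" "collapse t u v" and s: "s \<in> T" "collapse s v u"
  shows "T = collapse_family {(u, v), (v, u)} (stable_kernel ` T) UNIV"
proof
  show "collapse_family {(u, v), (v, u)} (stable_kernel ` T) UNIV \<subseteq> T"
  proof
    fix x assume "x \<in> collapse_family {(u, v), (v, u)} (stable_kernel ` T) UNIV"
    then have "collapse x u v \<or> collapse x v u" "stable_kernel x \<in> stable_kernel ` T"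
      by (auto simp: collapse_family_def)
    then show "x \<in> T"
      using isolated_swap_subset[OF T _ t s] isolated_swap_subset[OF T _ s t] pairs by blast
  qed
qed (use pairs in \<open>auto simp: collapse_family_def\<close>)

text \<open>Otherwise both points merged by \<open>y\<close> lie in the image \<open>A - {u}\<close>
  of \<open>x\<close>, and the product would fall below stable rank
  \<open>card A - 1\<close>.\<close>

lemma trifle_in_pair:
  assumes T: "isolated_subsemigroup (variant \<alpha>) T"
    and layer: "\<And>x. x \<in> T \<Longrightarrow> stable_rank \<alpha> x = card A - 1"
    and x: "x \<in> T" "collapse x u v" and y: "y \<in> T" "collapse y u' v'"
  shows "u = u' \<or> u = v'"
proof (rule ccontr)
  assume contr: "\<not> ?thesis"
  have "x \<star> y \<in> T" using isolated_mult[OF T] x y by blast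
  then obtain p q where "collapse (x \<star> y) p q" using layer ex_collapse by blast
  then have p: "p \<in> A" "\<alpha> ` (x \<star> y) ` A = A - {p}" by (auto simp: collapse_def)
  have xA: "\<alpha> ` x ` A = A - {u}" "u \<in> A" using x(2) by (auto simp: collapse_def)
  have "(\<alpha> \<circ> y) ` (A - {u}) = A - {p}"
    using p(2) unfolding image_mult xA(1) by (simp add: image_comp)
  then have "inj_on (\<alpha> \<circ> y) (A - {u})"
    using p(1) xA(2) by (intro eq_card_imp_inj_on) simp_all
  moreover have "u' \<in> A - {u}" "v' \<in> A - {u}" "u' \<noteq> v'" "\<alpha> (y u') = \<alpha> (y v')"
    using y(2) contr by (auto simp: collapse_def)
  ultimately show False using inj_onD[of "\<alpha> \<circ> y" "A - {u}" u' v'] by simp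
qed

lemma isolated_layer_cases:
  assumes T: "isolated_subsemigroup (variant \<alpha>) T"
    and layer: "\<And>x. x \<in> T \<Longrightarrow> stable_rank \<alpha> x = card A - 1"
  obtains u v where "\<And>x. x \<in> T \<Longrightarrow> collapse x u v"
      "T = collapse_family {(u, v)} (stable_kernel ` T) (stable_range ` T)"
  | u v where "\<And>x. x \<in> T \<Longrightarrow> collapse x u v \<or> collapse x v u" "u \<in> A" "v \<in> A" "u \<noteq> v"
      "T = collapse_family {(u, v), (v, u)} (stable_kernel ` T) UNIV"
  | u where "u \<in> A" "\<And>x. x \<in> T \<Longrightarrow> \<exists>v. collapse x u v" "1 < card {v. \<exists>x\<in>T. collapse x u v}"
      "T = collapse_family ({u} \<times> {v. \<exists>x\<in>T. collapse x u v}) UNIV (stable_range ` T)"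
proof -
  obtain x where x: "x \<in> T" using isolated_ex[OF T] by blast
  then obtain u v where uv: "collapse x u v" using layer ex_collapse by blast
  then have uvA: "u \<in> A" "v \<in> A" "u \<noteq> v" by (auto simp: collapse_def)
  have pair: "u = u' \<or> u = v'" if "x \<in> T" "collapse x u v" "y \<in> T" "collapse y u' v'" for x y u v u' v'
    by (rule trifle_in_pair[OF T _ that]) (rule layer)
  show thesis
  proof (cases "\<exists>y\<in>T. \<exists>p q. collapse y p q \<and> p \<noteq> u")
    case True
    then obtain y p q where y: "y \<in> T" "collapse y p q" "p \<noteq> u" by blast
    \<comment> \<open>\<open>u\<close> belongs to the pair of \<open>y\<close> but is not its trifle
      element, so it is the burdened one; conversely \<open>p\<close> belongs to
      \<open>{u, v}\<close>, so it is \<open>v\<close>.\<close>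
    then have vu: "collapse y v u"
      using pair[OF x uv y(1,2)] pair[OF y(1,2) x uv] by auto
    have pairs: "collapse z u v \<or> collapse z v u" if z: "z \<in> T" for z
    proof -
      obtain r w where rw: "collapse z r w" using layer[OF z] ex_collapse by blast
      then show ?thesis
        using pair[OF z rw x uv] pair[OF x uv z rw] pair[OF y(1) vu z rw] uvA by auto
    qed
    show thesis
      by (rule that(2)[OF _ uvA isolated_swap_eq[OF T _ x uv y(1) vu]]; rule pairs)
  next
    case False
    have u: "\<exists>w. collapse z u w" if z: "z \<in> T" for z
      using layer[OF z] ex_collapse False z by blast
    show thesis
    proof (cases "\<exists>y\<in>T. \<exists>w. collapse y u w \<and> w \<noteq> v")
      case True
      then obtain y w where y: "y \<in> T" "collapse y u w" "v \<noteq> w" by blast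
      have "card {v, w} \<le> card {v. \<exists>x\<in>T. collapse x u v}"
        using x uv y by (intro card_mono) auto
      then have "1 < card {v. \<exists>x\<in>T. collapse x u v}" using y(3) by simp
      then show thesis
        by (intro that(3)[OF uvA(1) _ _ isolated_times_eq[OF T _ x uv y]] u)
    next
      case False
      then have uv': "collapse z u v" if "z \<in> T" for z using u that by blast
      show thesis
        by (rule that(1)[OF _ isolated_singleton_eq[OF T]]; rule uv')
    qed
  qed
qed

text \<open>Everything below full stable rank is present, so only the part \<open>F\<close> of full
  stable rank is open. If it is empty, two different stable ranks lie below \<open>card A\<close>,
  hence \<open>2 < card A\<close>; otherwise it is isolated itself.\<close>

lemma isolated_mixed_cases:
  assumes T: "isolated_subsemigroup (variant \<alpha>) T"
    and xy: "x \<in> T" "y \<in> T" "stable_rank \<alpha> x < stable_rank \<alpha> y"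
  obtains "2 < card A" "T = {x. stable_rank \<alpha> x < card A}"
  | F where "1 < card A" "F \<noteq> {}" "\<And>x. x \<in> F \<Longrightarrow> stable_rank \<alpha> x = card A"
      "T = full_family (stable_kernel ` F) (stable_range ` F) \<union> {x. stable_rank \<alpha> x < card A}"
proof -
  have low: "z \<in> T" if "stable_rank \<alpha> z < card A" for z
    using low_stable_rank_in_isolated[OF T xy that] .
  have cases: "stable_rank \<alpha> z < card A \<or> stable_rank \<alpha> z = card A" for z
    using stable_rank_le[of z] by linarith
  define F where "F = {z \<in> T. stable_rank \<alpha> z = card A}"
  have T_eq: "T = F \<union> {z. stable_rank \<alpha> z < card A}"
    using low cases by (auto simp: F_def)
  show thesis
  proof (cases "F = {}")
    case True
    then have "stable_rank \<alpha> y < card A" using xy(2) cases[of y] by (auto simp: F_def)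
    then have "2 < card A" using xy(3) stable_rank_pos[of x] by linarith
    then show thesis using that(1) T_eq True by simp
  next
    case False
    have "isolated_subsemigroup (variant \<alpha>) F"
    proof (rule isolatedI)
      show "z \<star> w \<in> F" if "z \<in> F" "w \<in> F" for z w
        using that isolated_mult[OF T] stable_rank_mult_full_iff by (simp add: F_def)
      show "\<omega> z \<in> F \<longleftrightarrow> z \<in> F" for z
        using isolated_cyclic_idem[OF T] by (simp add: F_def)
    qed (rule False)
    then have F_eq: "F = full_family (stable_kernel ` F) (stable_range ` F)"
      by (rule isolated_full_eq) (simp add: F_def)
    show thesis
    proof (rule that(2))
      show "1 < card A"
        using xy(3) stable_rank_pos[of x] stable_rank_le[of y] by linarith
      show "stable_rank \<alpha> z = card A" if "z \<in> F" for z using that by (simp add: F_def)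
      show "T = full_family (stable_kernel ` F) (stable_range ` F) \<union> {x. stable_rank \<alpha> x < card A}"
        by (subst F_eq[symmetric]) (rule T_eq)
    qed (rule False)
  qed
qed

end

section \<open>The parameters of the classification\<close>

locale enumerated_variant = idempotent_variant \<alpha> for \<alpha> :: "'n::finite \<Rightarrow> 'n" +
  fixes a :: "nat \<Rightarrow> 'n"
  assumes bij_a: "bij_betw a {1..map_rank \<alpha>} (range \<alpha>)"
begin

abbreviation l where "l \<equiv> map_rank \<alpha>"

lemma card_A: "card A = l"
  by (simp only: A_def map_rank_def)

lemma A_eq: "A = a ` {1..l}"
  using bij_a unfolding A_def bij_betw_def by blast

lemma a_in_A [simp]: "k \<in> {1..l} \<Longrightarrow> a k \<in> A"
  using A_eq by blast

lemma a_eq_iff: "k \<in> {1..l} \<Longrightarrow> m \<in> {1..l} \<Longrightarrow> a k = a m \<longleftrightarrow> k = m"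
  using bij_a unfolding bij_betw_def by (metis inj_onD)

lemma A_minus_eq: "k \<in> {1..l} \<Longrightarrow> A - {a k} = a ` ({1..l} - {k})"
  unfolding A_eq using a_eq_iff by auto

lemma ex_index: "u \<in> A \<Longrightarrow> \<exists>k\<in>{1..l}. u = a k"
  using A_eq by blast

lemma collapse_index:
  assumes "collapse x u v"
  obtains k m where "k \<in> {1..l}" "m \<in> {1..l}" "k \<noteq> m" "u = a k" "v = a m"
proof -
  have "u \<in> A" "v \<in> A" "u \<noteq> v" using assms by (auto simp: collapse_def)
  then show thesis using that ex_index by metis
qed

text \<open>Uniqueness of the index pair gives the definite descriptions in \<open>trifle\<close>
  and \<open>burdened\<close> their meaning.\<close>

lemma trifle_burdened_iff:
  assumes x: "collapse x (a p) (a q)" and pq: "p \<in> {1..l}" "q \<in> {1..l}"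
  shows "trifle_burdened \<alpha> a (\<omega> x) k m \<longleftrightarrow> k = p \<and> m = q"
proof
  have ne: "a p \<noteq> a q" using x by (auto simp: collapse_def)
  have fix_q: "\<alpha> (\<omega> x (a q)) = a q"
    using collapse_cyclic_idem_fix[OF x a_in_A[OF pq(2)]] ne by metis
  have eq: "\<omega> x (a p) = \<omega> x (a q)" by (rule collapse_cyclic_idem_trifle[OF x])
  show "trifle_burdened \<alpha> a (\<omega> x) k m" if "k = p \<and> m = q"
    using that pq ne fix_q eq by (auto simp: trifle_burdened_def block_def)
  assume "trifle_burdened \<alpha> a (\<omega> x) k m"
  then have km: "k \<in> {1..l}" "m \<in> {1..l}" "k \<noteq> m" "\<omega> x (a m) = \<omega> x (a k)" "\<alpha> (\<omega> x (a m)) = a m"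
    by (auto simp: trifle_burdened_def block_def)
  have "{a m, a k} = {a p, a q}"
    using collapse_cyclic_idem_eq_iff[OF x, of "a m" "a k"] km a_eq_iff by simp
  moreover have "a m \<noteq> a p"
    using km(5) fix_q eq ne by metis
  ultimately have "a m = a q" "a k = a p" by (auto simp: doubleton_eq_iff)
  then show "k = p \<and> m = q" using a_eq_iff km pq by blast
qed

lemma trifle_eq:
  assumes "collapse x (a p) (a q)" "p \<in> {1..l}" "q \<in> {1..l}"
  shows "trifle \<alpha> a x = a p" "burdened \<alpha> a x = a q"
  unfolding trifle_def burdened_def trifle_burdened_iff[OF assms] by simp_all

lemma mem_trifle_layer:
  assumes k: "k \<in> {1..l}"
  shows "x \<in> trifle_layer \<alpha> a k \<and> burdened \<alpha> a x \<in> M \<longleftrightarrow> (\<exists>v\<in>M. collapse x (a k) v)"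
proof
  assume "x \<in> trifle_layer \<alpha> a k \<and> burdened \<alpha> a x \<in> M"
  then have x: "stable_rank \<alpha> x = card A - 1" "trifle \<alpha> a x = a k" "burdened \<alpha> a x \<in> M"
    by (auto simp: trifle_layer_def stable_layer_def card_A)
  then obtain u v where uv: "collapse x u v" using ex_collapse by blast
  obtain p q where pq: "p \<in> {1..l}" "q \<in> {1..l}" "u = a p" "v = a q"
    by (rule collapse_index[OF uv])
  have "trifle \<alpha> a x = u" "burdened \<alpha> a x = v"
    using trifle_eq[of x p q] uv pq by simp_all
  then show "\<exists>v\<in>M. collapse x (a k) v" using x uv by auto
next
  assume "\<exists>v\<in>M. collapse x (a k) v"
  then obtain v where v: "v \<in> M" "collapse x (a k) v" by blast
  obtain p q where pq: "p \<in> {1..l}" "q \<in> {1..l}" "a k = a p" "v = a q"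
    by (rule collapse_index[OF v(2)])
  then show "x \<in> trifle_layer \<alpha> a k \<and> burdened \<alpha> a x \<in> M"
    using v trifle_eq[of x p q] collapse_stable_rank(1)[OF v(2)]
    by (simp add: trifle_layer_def stable_layer_def card_A)
qed

lemma mem_trifle_burdened_layer:
  assumes "k \<in> {1..l}"
  shows "x \<in> trifle_burdened_layer \<alpha> a k m \<longleftrightarrow> collapse x (a k) (a m)"
  using mem_trifle_layer[OF assms, of x "{a m}"] by (simp add: trifle_burdened_layer_def)

text \<open>Root sets of idempotents are the fibres of \<open>\<omega>\<close>, so each listed union
  becomes a condition on \<open>\<omega> x\<close>.\<close>

lemma Union_root_set:
  "\<Union> {root_set (variant \<alpha>) \<epsilon> | \<epsilon>. idempotent \<epsilon> \<and> Q \<epsilon>} = {x. Q (\<omega> x)}"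
proof -
  have "(\<exists>\<epsilon>. idempotent \<epsilon> \<and> Q \<epsilon> \<and> x \<in> root_set (variant \<alpha>) \<epsilon>) \<longleftrightarrow> Q (\<omega> x)" for x
    using idem_cyclic_idem[of x] by (auto simp: root_set_idem)
  then show ?thesis by blast
qed

lemma F_set_eq: "F_set \<alpha> X Y = full_family X Y"
proof -
  have "F_set \<alpha> X Y = {x. map_rank (\<omega> x) = l \<and> stable_kernel x \<in> X \<and> stable_range x \<in> Y}"
    unfolding F_set_def by (rule Union_root_set)
  then show ?thesis by (simp add: full_family_def stable_rank_def card_A)
qed

lemma H_set_eq:
  assumes "k \<in> {1..l}"
  shows "H_set \<alpha> a k m X Y = collapse_family {(a k, a m)} X Y"
proof -
  have "H_set \<alpha> a k m X Y =
      {x. \<omega> x \<in> trifle_burdened_layer \<alpha> a k m \<and> stable_kernel x \<in> X \<and> stable_range x \<in> Y}"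
    unfolding H_set_def by (rule Union_root_set)
  then show ?thesis by (simp add: collapse_family_def mem_trifle_burdened_layer[OF assms])
qed

lemma K_set_eq:
  assumes "k \<in> {1..l}" "m \<in> {1..l}" "k \<noteq> m"
  shows "K_set \<alpha> a {k, m} X = collapse_family {(a k, a m), (a m, a k)} X UNIV"
proof -
  have "K_set \<alpha> a {k, m} X =
      {x. (\<exists>p q. {k, m} = {p, q} \<and> p \<noteq> q \<and> \<omega> x \<in> trifle_burdened_layer \<alpha> a p q) \<and>
        stable_kernel x \<in> X}"
    unfolding K_set_def by (rule Union_root_set)
  moreover have "(\<exists>p q. {k, m} = {p, q} \<and> p \<noteq> q \<and> \<omega> x \<in> trifle_burdened_layer \<alpha> a p q) \<longleftrightarrow>
      collapse x (a k) (a m) \<or> collapse x (a m) (a k)" for x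
    using assms mem_trifle_burdened_layer[OF assms(1), of "\<omega> x" m]
      mem_trifle_burdened_layer[OF assms(2), of "\<omega> x" k]
    by (auto simp: doubleton_eq_iff)
  ultimately show ?thesis by (simp add: collapse_family_def)
qed

lemma L_set_eq:
  assumes "k \<in> {1..l}"
  shows "L_set \<alpha> a k M Y = collapse_family ({a k} \<times> M) UNIV Y"
proof -
  have "L_set \<alpha> a k M Y =
      {x. \<omega> x \<in> trifle_layer \<alpha> a k \<and> burdened \<alpha> a (\<omega> x) \<in> M \<and> stable_range x \<in> Y}"
    unfolding L_set_def by (rule Union_root_set)
  moreover have "\<omega> x \<in> trifle_layer \<alpha> a k \<and> burdened \<alpha> a (\<omega> x) \<in> M \<longleftrightarrow>
      (\<exists>v\<in>M. collapse x (a k) v)" for x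
    using mem_trifle_layer[OF assms, of "\<omega> x" M] by simp
  ultimately show ?thesis unfolding set_eq_iff mem_collapse_family by blast
qed

lemma Low_eq: "UNIV - stable_layer \<alpha> l = {x. stable_rank \<alpha> x < card A}"
  using stable_rank_le by (auto simp: stable_layer_def card_A le_less)

text \<open>A choice function for \<open>B\<close> is recovered as the inverse of \<alpha> on
  \<open>B\<close> after \<open>a\<close>. All indices give \<open>Y_all\<close>, all but
  \<open>k\<close> give \<open>V_all\<close>.\<close>

lemma transversal_iff:
  assumes J: "J \<subseteq> {1..l}"
  shows "(\<exists>b. B = b ` J \<and> (\<forall>i\<in>J. \<alpha> (b i) = a i)) \<longleftrightarrow> inj_on \<alpha> B \<and> \<alpha> ` B = a ` J"
proof
  assume "\<exists>b. B = b ` J \<and> (\<forall>i\<in>J. \<alpha> (b i) = a i)"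
  then obtain b where b: "B = b ` J" "\<And>i. i \<in> J \<Longrightarrow> \<alpha> (b i) = a i" by blast
  have "inj_on \<alpha> B"
  proof (rule inj_onI)
    fix c d assume "c \<in> B" "d \<in> B" and eq: "\<alpha> c = \<alpha> d"
    then obtain i j where ij: "i \<in> J" "j \<in> J" "c = b i" "d = b j" using b(1) by blast
    then have "a i = a j" using b(2) eq by metis
    then show "c = d" using ij J a_eq_iff by blast
  qed
  moreover have "\<alpha> ` B = a ` J"
    unfolding b(1) image_image by (rule image_cong[OF refl b(2)])
  ultimately show "inj_on \<alpha> B \<and> \<alpha> ` B = a ` J" ..
next
  assume B: "inj_on \<alpha> B \<and> \<alpha> ` B = a ` J"
  let ?b = "inv_into B \<alpha> \<circ> a"
  have "?b ` J = inv_into B \<alpha> ` \<alpha> ` B" unfolding image_comp[symmetric] using B by metis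
  moreover have "inv_into B \<alpha> ` \<alpha> ` B = B"
    by (rule inv_into_image_cancel[OF conjunct1[OF B] subset_refl])
  ultimately have "B = ?b ` J" by metis
  moreover have "\<alpha> (?b i) = a i" if "i \<in> J" for i
    unfolding comp_apply by (rule f_inv_into_f) (use that B in blast)
  ultimately show "\<exists>b. B = b ` J \<and> (\<forall>i\<in>J. \<alpha> (b i) = a i)" by blast
qed

lemma V_all_iff:
  assumes "k \<in> {1..l}"
  shows "B \<in> V_all \<alpha> a k \<longleftrightarrow> inj_on \<alpha> B \<and> \<alpha> ` B = A - {a k}"
proof -
  have "B \<in> V_all \<alpha> a k \<longleftrightarrow> (\<exists>b. B = b ` ({1..l} - {k}) \<and> (\<forall>i\<in>{1..l} - {k}. \<alpha> (b i) = a i))"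
    by (simp only: V_all_def block_def vimage_singleton_eq mem_Collect_eq)
  also have "\<dots> \<longleftrightarrow> inj_on \<alpha> B \<and> \<alpha> ` B = A - {a k}"
    unfolding A_minus_eq[OF assms] by (rule transversal_iff) blast
  finally show ?thesis .
qed

lemma Y_all_iff: "B \<in> Y_all \<alpha> a \<longleftrightarrow> inj_on \<alpha> B \<and> \<alpha> ` B = A"
proof -
  have "B \<in> Y_all \<alpha> a \<longleftrightarrow> (\<exists>b. B = b ` {1..l} \<and> (\<forall>i\<in>{1..l}. \<alpha> (b i) = a i))"
    by (simp only: Y_all_def block_def vimage_singleton_eq mem_Collect_eq)
  also have "\<dots> \<longleftrightarrow> inj_on \<alpha> B \<and> \<alpha> ` B = A"
    unfolding A_eq by (rule transversal_iff) blast
  finally show ?thesis .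
qed

lemma U_all_iff:
  "P \<in> U_all \<alpha> a k m \<longleftrightarrow> partition_on UNIV P \<and> card P = card A - 1 \<and>
     (\<forall>B\<in>P. \<exists>c\<in>A. c \<in> B) \<and> (\<exists>B\<in>P. a k \<in> B \<and> a m \<in> B)"
  unfolding U_all_def card_A unfolding A_eq by simp

lemma U_all_commute: "U_all \<alpha> a k m = U_all \<alpha> a m k"
  unfolding set_eq_iff U_all_iff by blast

lemma X_all_iff:
  "P \<in> X_all \<alpha> a \<longleftrightarrow> partition_on UNIV P \<and> card P = card A \<and>
     (\<forall>B\<in>P. \<forall>c\<in>A. \<forall>d\<in>A. c \<in> B \<and> d \<in> B \<longrightarrow> c = d)"
proof -
  have "(\<forall>c\<in>A. \<forall>d\<in>A. c \<in> B \<and> d \<in> B \<longrightarrow> c = d) \<longleftrightarrow>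
      (\<forall>i\<in>{1..l}. \<forall>j\<in>{1..l}. a i \<in> B \<and> a j \<in> B \<longrightarrow> i = j)" for B
    unfolding A_eq ball_simps
    by (rule ball_cong[OF refl], rule ball_cong[OF refl]) (metis a_eq_iff)
  then show ?thesis by (simp add: X_all_def card_A)
qed

lemma full_kernel_in: "stable_rank \<alpha> x = card A \<Longrightarrow> stable_kernel x \<in> X_all \<alpha> a"
proof -
  assume x: "stable_rank \<alpha> x = card A"
  have "c = d" if "B \<in> stable_kernel x" "c \<in> A" "d \<in> A" "c \<in> B" "d \<in> B" for B c d
  proof -
    have "\<omega> x c = \<omega> x d" using that by (auto simp: map_kernel_eq)
    then show ?thesis using idem_full_fix[OF x that(2)] idem_full_fix[OF x that(3)] by metis
  qed
  then show ?thesis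
    using x unfolding X_all_iff by (auto simp: map_kernel_partition card_map_kernel stable_rank_def)
qed

lemma full_range_in: "stable_rank \<alpha> x = card A \<Longrightarrow> stable_range x \<in> Y_all \<alpha> a"
  using Y_all_iff full_range idem_inj_on[OF idem_cyclic_idem] by blast

lemma collapse_kernel_in:
  assumes "collapse x (a k) (a m)"
  shows "stable_kernel x \<in> U_all \<alpha> a k m"
proof -
  have "\<exists>c\<in>A. c \<in> B" if B: "B \<in> stable_kernel x" for B
  proof -
    obtain z where z: "B = {z'. \<omega> x z = \<omega> x z'}" using B by (auto simp: map_kernel_eq)
    have "\<omega> x (\<alpha> (\<omega> x z)) = \<omega> x z" using idem_cyclic_idem[of x] by (simp add: idem_iff)
    then have "\<alpha> (\<omega> x z) \<in> B" using z by simp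
    then show ?thesis using alpha_in_A by blast
  qed
  moreover have "\<exists>B\<in>stable_kernel x. a k \<in> B \<and> a m \<in> B"
    using collapse_cyclic_idem_trifle[OF assms] by (auto simp: map_kernel_eq)
  moreover have "card (stable_kernel x) = card A - 1"
    using collapse_stable_rank(1)[OF assms] by (simp add: card_map_kernel stable_rank_def)
  ultimately show ?thesis
    unfolding U_all_iff using map_kernel_partition by blast
qed

lemma collapse_range_in:
  assumes "collapse x (a k) v" "k \<in> {1..l}"
  shows "stable_range x \<in> V_all \<alpha> a k"
  using V_all_iff[OF assms(2)] collapse_range[OF assms(1)] idem_inj_on[OF idem_cyclic_idem] by blast

section \<open>Existence of elements with prescribed parameters\<close>

lemma ex_full:
  assumes P: "P \<in> X_all \<alpha> a" and B: "B \<in> Y_all \<alpha> a"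
  shows "\<exists>e. stable_rank \<alpha> e = card A \<and> stable_kernel e = P \<and> stable_range e = B"
proof -
  have part: "partition_on UNIV P" and card: "card P = card A"
    and one: "\<And>p c d. p \<in> P \<Longrightarrow> c \<in> A \<Longrightarrow> d \<in> A \<Longrightarrow> c \<in> p \<Longrightarrow> d \<in> p \<Longrightarrow> c = d"
    using P unfolding X_all_iff by blast+
  have \<alpha>B: "inj_on \<alpha> B" "\<alpha> ` B = A" using B unfolding Y_all_iff by blast+
  have "\<forall>c. \<exists>p. p \<in> P \<and> c \<in> p" using partition_onD1[OF part] by blast
  then obtain p where p: "p c \<in> P" "c \<in> p c" for c by metis
  \<comment> \<open>Points of \<open>A\<close> lie in different blocks and there are as many blocks
    as points, so each block contains exactly one.\<close>
  have "inj_on p A" using one p by (metis inj_onI)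
  then have "p ` A = P" using card p(1) by (intro card_subset_eq) (auto simp: card_image)
  then have "\<exists>c\<in>A. c \<in> q" if "q \<in> P" for q using that p(2) by blast
  then have "\<exists>!c. c \<in> q \<and> c \<in> \<alpha> ` B" if "q \<in> P" for q
    using that one unfolding \<alpha>B(2) by blast
  then obtain e where e: "idempotent e" "map_kernel e = P" "range e = B"
    using ex_idem_kernel_range[OF part \<alpha>B(1)] by blast
  moreover have "stable_rank \<alpha> e = card A"
    using stable_rank_idem[OF e(1)] e(3) \<alpha>B card_image by metis
  ultimately show ?thesis using cyclic_idem_idem by metis
qed

lemma ex_collapse_kernel_range:
  assumes k: "k \<in> {1..l}" and m: "m \<in> {1..l}" "k \<noteq> m"
    and P: "P \<in> U_all \<alpha> a k m" and B: "B \<in> V_all \<alpha> a k"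
  shows "\<exists>e. collapse e (a k) (a m) \<and> stable_kernel e = P \<and> stable_range e = B"
proof -
  have part: "partition_on UNIV P" and card: "card P = card A - 1"
    and some: "\<And>p. p \<in> P \<Longrightarrow> \<exists>c\<in>A. c \<in> p" and km: "\<exists>p\<in>P. a k \<in> p \<and> a m \<in> p"
    using P unfolding U_all_iff by blast+
  have \<alpha>B: "inj_on \<alpha> B" "\<alpha> ` B = A - {a k}" using B unfolding V_all_iff[OF k] by blast+
  have ne: "a m \<noteq> a k" using a_eq_iff k m by metis
  have "\<forall>c. \<exists>p. p \<in> P \<and> c \<in> p" using partition_onD1[OF part] by blast
  then obtain p where p: "p c \<in> P" "c \<in> p c" for c by metis
  have p_eq: "q = p c" if "q \<in> P" "c \<in> q" for q c
    using partition_onD2[OF part] that p[of c] unfolding disjoint_def by blast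
  have p_km: "p (a k) = p (a m)" using km p_eq by metis
  \<comment> \<open>The block of \<open>a k\<close> also contains \<open>a m\<close>, so every block
    still meets \<open>A\<close> after \<open>a k\<close> is dropped; by counting, the remaining
    points are then spread one per block.\<close>
  have some': "\<exists>c\<in>A - {a k}. c \<in> q" if q: "q \<in> P" for q
  proof -
    obtain c where c: "c \<in> A" "c \<in> q" using some[OF q] by blast
    show ?thesis
    proof (cases "c = a k")
      case True
      then have "a m \<in> q" using p_eq[OF q c(2)] p_km p(2)[of "a m"] by simp
      then show ?thesis using ne m(1) by (intro bexI[of _ "a m"]) simp_all
    qed (use c in blast)
  qed
  have "p ` (A - {a k}) = P"
  proof
    show "P \<subseteq> p ` (A - {a k})" using some' p_eq by blast
  qed (use p(1) in blast)
  then have inj: "inj_on p (A - {a k})"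
    using card k by (intro eq_card_imp_inj_on) simp_all
  have "\<exists>!c. c \<in> q \<and> c \<in> \<alpha> ` B" if q: "q \<in> P" for q
  proof -
    obtain c where c: "c \<in> A - {a k}" "c \<in> q" using some'[OF q] by blast
    then show ?thesis
      unfolding \<alpha>B(2) using p_eq[OF q] inj_onD[OF inj] by metis
  qed
  then obtain e where e: "idempotent e" "map_kernel e = P" "range e = B"
    using ex_idem_kernel_range[OF part \<alpha>B(1)] by blast
  have "\<alpha> ` e ` A = A - {a k}" using idem_range[OF e(1)] e(3) \<alpha>B(2) by simp
  moreover have "e (a k) = e (a m)"
  proof -
    obtain q where "q \<in> P" "a k \<in> q" "a m \<in> q" using km by blast
    then show ?thesis using e(2) by (auto simp: map_kernel_eq)
  qed
  ultimately have "collapse e (a k) (a m)"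
    using k m ne by (auto simp: collapse_def)
  then show ?thesis using e cyclic_idem_idem by metis
qed

lemma ex_collapse_kernel:
  assumes "k \<in> {1..l}" "m \<in> {1..l}" "k \<noteq> m" "P \<in> U_all \<alpha> a k m"
  shows "\<exists>e. collapse e (a k) (a m) \<and> stable_kernel e = P"
proof -
  have "A - {a k} \<in> V_all \<alpha> a k"
    unfolding V_all_iff[OF assms(1)] by (auto intro!: inj_onI simp: image_iff)
  then show ?thesis using ex_collapse_kernel_range[OF assms] by blast
qed

lemma ex_collapse_range:
  assumes k: "k \<in> {1..l}" and v: "v \<in> A - {a k}" and B: "B \<in> V_all \<alpha> a k"
  shows "\<exists>e. collapse e (a k) v \<and> stable_range e = B"
proof -
  have \<alpha>B: "inj_on \<alpha> B" "\<alpha> ` B = A - {a k}" using B unfolding V_all_iff[OF k] by blast+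
  \<comment> \<open>The simplest collapse of \<open>A\<close>, extended to all points through
    \<alpha> and lifted into \<open>B\<close> along the inverse of \<alpha> on
    \<open>B\<close>.\<close>
  let ?g = "\<lambda>c. if c = a k then v else c"
  have g: "?g (\<alpha> z) \<in> \<alpha> ` B" for z using v \<alpha>B(2) by simp
  define e where "e z = inv_into B \<alpha> (?g (\<alpha> z))" for z
  have \<alpha>e: "\<alpha> (e z) = ?g (\<alpha> z)" for z
    unfolding e_def by (rule f_inv_into_f[OF g])
  have e_fix: "e c = c" if "c \<in> B" for c
  proof -
    have "\<alpha> c \<noteq> a k" using that \<alpha>B(2) by blast
    then show ?thesis using that \<alpha>B(1) by (simp add: e_def)
  qed
  have "e (\<alpha> (e z)) = e z" for z
    using \<alpha>e[of z] v by (simp add: e_def)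
  then have e: "idempotent e" by (simp add: idem_iff)
  have range_e: "range e = B"
  proof
    show "range e \<subseteq> B" unfolding e_def using inv_into_into[OF g] by blast
    show "B \<subseteq> range e" using e_fix by (metis rangeI subsetI)
  qed
  have "\<alpha> ` e ` A = A - {a k}" using idem_range[OF e] range_e \<alpha>B(2) by simp
  then have "collapse e (a k) v"
    using k v \<alpha>e by (auto simp: collapse_def)
  then show ?thesis using range_e cyclic_idem_idem[OF e] by metis
qed

section \<open>The classification\<close>

definition fulls where "fulls T = {x \<in> T. stable_rank \<alpha> x = card A}"

definition pairs where "pairs T = {(u, v). \<exists>x\<in>T. collapse x u v}"

text \<open>Every kernel in \<open>X\<close> occurs together with every range in \<open>Y\<close>;
  as neither set is empty, both can be read off from the family.\<close>

lemma full_family_parameters: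
  assumes "X \<subseteq> X_all \<alpha> a" "Y \<subseteq> Y_all \<alpha> a" "X \<noteq> {}" "Y \<noteq> {}"
  shows "stable_kernel ` full_family X Y = X" "stable_range ` full_family X Y = Y"
    "full_family X Y \<noteq> {}"
proof -
  have ex: "\<exists>e\<in>full_family X Y. stable_kernel e = P \<and> stable_range e = B"
    if "P \<in> X" "B \<in> Y" for P B
    using ex_full[of P B] that assms(1,2) unfolding full_family_def by blast
  have sub: "stable_kernel ` full_family X Y \<subseteq> X" "stable_range ` full_family X Y \<subseteq> Y"
    by (auto simp: full_family_def)
  obtain P0 B0 where PB: "P0 \<in> X" "B0 \<in> Y" using assms(3,4) by blast
  have "X \<subseteq> stable_kernel ` full_family X Y"
    unfolding subset_iff image_iff using ex[OF _ PB(2)] by metis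
  moreover have "Y \<subseteq> stable_range ` full_family X Y"
    unfolding subset_iff image_iff using ex[OF PB(1)] by metis
  ultimately show "stable_kernel ` full_family X Y = X" "stable_range ` full_family X Y = Y"
    using sub by (simp_all only: subset_antisym)
  show "full_family X Y \<noteq> {}" using ex[OF PB] by blast
qed

lemma singleton_family_parameters:
  assumes km: "k \<in> {1..l}" "m \<in> {1..l}" "k \<noteq> m"
    and XY: "X \<subseteq> U_all \<alpha> a k m" "Y \<subseteq> V_all \<alpha> a k" "X \<noteq> {}" "Y \<noteq> {}"
  defines "T \<equiv> collapse_family {(a k, a m)} X Y"
  shows "stable_kernel ` T = X" "stable_range ` T = Y" "pairs T = {(a k, a m)}"
proof -
  have ex: "\<exists>e\<in>T. stable_kernel e = P \<and> stable_range e = B" if PB: "P \<in> X" "B \<in> Y" for P B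
  proof -
    obtain e where "collapse e (a k) (a m)" "stable_kernel e = P" "stable_range e = B"
      using ex_collapse_kernel_range[OF km subsetD[OF XY(1) PB(1)] subsetD[OF XY(2) PB(2)]] by blast
    with PB show ?thesis by (intro bexI[of _ e]) (simp_all add: T_def collapse_family_def)
  qed
  have sub: "stable_kernel ` T \<subseteq> X" "stable_range ` T \<subseteq> Y"
    by (auto simp: T_def collapse_family_def)
  obtain P0 B0 where PB: "P0 \<in> X" "B0 \<in> Y" using XY(3,4) by blast
  have "X \<subseteq> stable_kernel ` T"
    unfolding subset_iff image_iff using ex[OF _ PB(2)] by metis
  moreover have "Y \<subseteq> stable_range ` T"
    unfolding subset_iff image_iff using ex[OF PB(1)] by metis
  ultimately show "stable_kernel ` T = X" "stable_range ` T = Y"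
    using sub by (simp_all only: subset_antisym)
  have col: "collapse x (a k) (a m)" if "x \<in> T" for x
    using that by (simp add: T_def collapse_family_def)
  obtain e where e: "e \<in> T" using ex[OF PB] by blast
  show "pairs T = {(a k, a m)}"
  proof
    show "pairs T \<subseteq> {(a k, a m)}"
      unfolding pairs_def using col collapse_unique by blast
    show "{(a k, a m)} \<subseteq> pairs T"
      unfolding pairs_def using col e by blast
  qed
qed

lemma swap_family_parameters:
  assumes km: "k \<in> {1..l}" "m \<in> {1..l}" "k \<noteq> m"
    and X: "X \<subseteq> U_all \<alpha> a k m" "X \<noteq> {}"
  defines "T \<equiv> collapse_family {(a k, a m), (a m, a k)} X UNIV"
  shows "stable_kernel ` T = X" "pairs T = {(a k, a m), (a m, a k)}"
proof -
  have ex: "\<exists>e\<in>T. collapse e (a k) (a m) \<and> stable_kernel e = P" if P: "P \<in> X" for P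
  proof -
    obtain e where "collapse e (a k) (a m)" "stable_kernel e = P"
      using ex_collapse_kernel[OF km subsetD[OF X(1) P]] by blast
    with P show ?thesis by (intro bexI[of _ e]) (simp_all add: T_def collapse_family_def)
  qed
  have ex': "\<exists>e\<in>T. collapse e (a m) (a k)"
  proof -
    obtain P where P: "P \<in> X" using X(2) by blast
    then have "P \<in> U_all \<alpha> a m k" using X(1) U_all_commute[of k m] by auto
    then obtain e where "collapse e (a m) (a k)" "stable_kernel e = P"
      using ex_collapse_kernel[OF km(2,1) km(3)[symmetric]] by blast
    with P show ?thesis by (intro bexI[of _ e]) (simp_all add: T_def collapse_family_def)
  qed
  have sub: "stable_kernel ` T \<subseteq> X"
    by (auto simp: T_def collapse_family_def)
  have "X \<subseteq> stable_kernel ` T" unfolding subset_iff image_iff using ex by metis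
  with sub show "stable_kernel ` T = X" by (rule subset_antisym)
  have col: "collapse x (a k) (a m) \<or> collapse x (a m) (a k)" if "x \<in> T" for x
    using that by (auto simp: T_def collapse_family_def)
  show "pairs T = {(a k, a m), (a m, a k)}"
  proof
    show "pairs T \<subseteq> {(a k, a m), (a m, a k)}"
    proof
      fix p assume "p \<in> pairs T"
      then obtain u v x where x: "p = (u, v)" "x \<in> T" "collapse x u v"
        unfolding pairs_def by blast
      then show "p \<in> {(a k, a m), (a m, a k)}"
        using col[OF x(2)] collapse_unique[OF x(3)] by blast
    qed
    obtain P where "P \<in> X" using X(2) by blast
    then show "{(a k, a m), (a m, a k)} \<subseteq> pairs T"
      unfolding pairs_def using ex ex' by blast
  qed
qed

lemma times_family_parameters:
  assumes k: "k \<in> {1..l}" and M: "M \<subseteq> A - {a k}" "M \<noteq> {}"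
    and Y: "Y \<subseteq> V_all \<alpha> a k" "Y \<noteq> {}"
  defines "T \<equiv> collapse_family ({a k} \<times> M) UNIV Y"
  shows "stable_range ` T = Y" "pairs T = {a k} \<times> M"
proof -
  have ex: "\<exists>e\<in>T. collapse e (a k) v \<and> stable_range e = B" if vB: "v \<in> M" "B \<in> Y" for v B
  proof -
    obtain e where "collapse e (a k) v" "stable_range e = B"
      using ex_collapse_range[OF k subsetD[OF M(1) vB(1)] subsetD[OF Y(1) vB(2)]] by blast
    with vB show ?thesis by (intro bexI[of _ e]) (auto simp: T_def collapse_family_def)
  qed
  obtain v0 B0 where vB: "v0 \<in> M" "B0 \<in> Y" using M(2) Y(2) by blast
  have sub: "stable_range ` T \<subseteq> Y"
    by (auto simp: T_def collapse_family_def)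
  have "Y \<subseteq> stable_range ` T" unfolding subset_iff image_iff using ex[OF vB(1)] by metis
  with sub show "stable_range ` T = Y" by (rule subset_antisym)
  have col: "\<exists>v\<in>M. collapse x (a k) v" if "x \<in> T" for x
    using that by (auto simp: T_def collapse_family_def)
  show "pairs T = {a k} \<times> M"
  proof
    show "pairs T \<subseteq> {a k} \<times> M"
    proof
      fix p assume "p \<in> pairs T"
      then obtain u v x where x: "p = (u, v)" "x \<in> T" "collapse x u v"
        unfolding pairs_def by blast
      then show "p \<in> {a k} \<times> M"
        using col[OF x(2)] collapse_unique[OF x(3)] by blast
    qed
    show "{a k} \<times> M \<subseteq> pairs T"
      unfolding pairs_def using ex vB(2) by blast
  qed
qed

lemma admissible_isolated:
  assumes p: "admissible \<alpha> a p"
  shows "isolated_subsemigroup (variant \<alpha>) (item_set \<alpha> a p)"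
proof (cases p)
  case (Item_F X Y)
  then have "full_family X Y \<noteq> {}"
    using p by (intro full_family_parameters(3)) simp_all
  then show ?thesis
    using Item_F isolated_full_family by (simp add: F_set_eq)
next
  case (Item_H k m X Y)
  then have km: "k \<in> {1..l}" "m \<in> {1..l}" "k \<noteq> m"
    and XY: "X \<subseteq> U_all \<alpha> a k m" "Y \<subseteq> V_all \<alpha> a k" "X \<noteq> {}" "Y \<noteq> {}"
    using p by simp_all
  have "collapse_family {(a k, a m)} X Y \<noteq> {}"
    using singleton_family_parameters(1)[OF km XY] XY(3) by force
  then show ?thesis
    unfolding Item_H item_set.simps H_set_eq[OF km(1)]
    by (rule isolated_collapse_family_singleton)
next
  case (Item_K q X)
  then obtain k m where km: "k \<in> {1..l}" "m \<in> {1..l}" "k \<noteq> m" and q: "q = {k, m}"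
    and X: "X \<subseteq> U_all \<alpha> a k m" "X \<noteq> {}"
    using p by auto
  have "collapse_family {(a k, a m), (a m, a k)} X UNIV \<noteq> {}"
    using swap_family_parameters(1)[OF km X] X(2) by force
  then show ?thesis
    unfolding Item_K item_set.simps q K_set_eq[OF km]
    by (rule isolated_collapse_family_swap)
next
  case (Item_L k M Y)
  then have k: "k \<in> {1..l}" and M: "M \<subseteq> A - {a k}" "M \<noteq> {}"
    and Y: "Y \<subseteq> V_all \<alpha> a k" "Y \<noteq> {}"
    using p A_minus_eq[of k] by auto
  have "collapse_family ({a k} \<times> M) UNIV Y \<noteq> {}"
    using times_family_parameters(1)[OF k M Y] Y(2) by force
  then show ?thesis
    unfolding Item_L item_set.simps L_set_eq[OF k]
    by (rule isolated_collapse_family_times)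
next
  case Item_Low
  then show ?thesis
    using p isolated_low by (simp add: Low_eq card_A)
next
  case (Item_F_Low X Y)
  then have "full_family X Y \<noteq> {}"
    using p by (intro full_family_parameters(3)) simp_all
  then show ?thesis
    using p Item_F_Low isolated_full_family_low by (simp add: F_set_eq Low_eq card_A)
qed

lemma full_parameters_admissible:
  assumes "\<And>x. x \<in> T \<Longrightarrow> stable_rank \<alpha> x = card A" "T \<noteq> {}"
  shows "stable_kernel ` T \<noteq> {} \<and> stable_kernel ` T \<subseteq> X_all \<alpha> a \<and>
    stable_range ` T \<noteq> {} \<and> stable_range ` T \<subseteq> Y_all \<alpha> a"
  using assms full_kernel_in full_range_in by blast

lemma isolated_admissible:
  assumes T: "isolated_subsemigroup (variant \<alpha>) T"
  shows "\<exists>p. admissible \<alpha> a p \<and> T = item_set \<alpha> a p"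
proof -
  obtain x0 where x0: "x0 \<in> T" using isolated_ex[OF T] by blast
  then have ne: "T \<noteq> {}" by blast
  show ?thesis
  proof (cases "\<exists>x\<in>T. \<exists>y\<in>T. stable_rank \<alpha> x < stable_rank \<alpha> y")
    case True
    then obtain x y where xy: "x \<in> T" "y \<in> T" "stable_rank \<alpha> x < stable_rank \<alpha> y" by blast
    show ?thesis
    proof (rule isolated_mixed_cases[OF T xy])
      assume "2 < card A" "T = {x. stable_rank \<alpha> x < card A}"
      then show ?thesis
        by (intro exI[of _ Item_Low]) (simp add: Low_eq card_A)
    next
      fix F
      assume F: "1 < card A" "F \<noteq> {}" "\<And>x. x \<in> F \<Longrightarrow> stable_rank \<alpha> x = card A"
        "T = full_family (stable_kernel ` F) (stable_range ` F) \<union> {x. stable_rank \<alpha> x < card A}"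
      have "T = item_set \<alpha> a (Item_F_Low (stable_kernel ` F) (stable_range ` F))"
        unfolding item_set.simps F_set_eq Low_eq by (rule F(4))
      moreover have "admissible \<alpha> a (Item_F_Low (stable_kernel ` F) (stable_range ` F))"
        using full_parameters_admissible[OF F(3,2)] F(1) by (simp add: card_A)
      ultimately show ?thesis by blast
    qed
  next
    case False
    then have layer: "stable_rank \<alpha> x = stable_rank \<alpha> x0" if "x \<in> T" for x
      using x0 that by (meson linorder_neqE_nat)
    consider "stable_rank \<alpha> x0 = card A" | "stable_rank \<alpha> x0 = card A - 1"
      using stable_rank_of_layer[OF T, of "stable_rank \<alpha> x0"] layer by blast
    then show ?thesis
    proof cases
      case 1
      have full: "stable_rank \<alpha> x = card A" if "x \<in> T" for x using layer[OF that] 1 by simp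
      have "T = item_set \<alpha> a (Item_F (stable_kernel ` T) (stable_range ` T))"
        unfolding item_set.simps F_set_eq by (rule isolated_full_eq[OF T full])
      moreover have "admissible \<alpha> a (Item_F (stable_kernel ` T) (stable_range ` T))"
        using full_parameters_admissible[OF full ne] by simp
      ultimately show ?thesis by blast
    next
      case 2
      have sub: "stable_rank \<alpha> x = card A - 1" if "x \<in> T" for x using layer[OF that] 2 by simp
      have l: "1 < l"
        using ex_collapse[OF 2] collapse_stable_rank(2) card_A by metis
      show ?thesis
      proof (rule isolated_layer_cases[OF T])
        show "stable_rank \<alpha> x = card A - 1" if "x \<in> T" for x by (rule sub[OF that])
      next
        fix u v
        assume uv: "\<And>x. x \<in> T \<Longrightarrow> collapse x u v"
          and T_eq: "T = collapse_family {(u, v)} (stable_kernel ` T) (stable_range ` T)"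
        obtain k m where km: "k \<in> {1..l}" "m \<in> {1..l}" "k \<noteq> m" "u = a k" "v = a m"
          by (rule collapse_index[OF uv[OF x0]])
        have "T = item_set \<alpha> a (Item_H k m (stable_kernel ` T) (stable_range ` T))"
          unfolding item_set.simps H_set_eq[OF km(1)] using T_eq km(4,5) by metis
        moreover have "stable_kernel ` T \<subseteq> U_all \<alpha> a k m" "stable_range ` T \<subseteq> V_all \<alpha> a k"
          using collapse_kernel_in collapse_range_in[OF _ km(1)] uv km(4,5) by blast+
        then have "admissible \<alpha> a (Item_H k m (stable_kernel ` T) (stable_range ` T))"
          using km l ne by simp
        ultimately show ?thesis by blast
      next
        fix u v
        assume uv: "\<And>x. x \<in> T \<Longrightarrow> collapse x u v \<or> collapse x v u" "u \<in> A" "v \<in> A" "u \<noteq> v"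
          and T_eq: "T = collapse_family {(u, v), (v, u)} (stable_kernel ` T) UNIV"
        obtain k m where km: "k \<in> {1..l}" "m \<in> {1..l}" "u = a k" "v = a m"
          using ex_index uv(2,3) by blast
        have ne_km: "k \<noteq> m" using km(3,4) uv(4) by blast
        have "T = item_set \<alpha> a (Item_K {k, m} (stable_kernel ` T))"
          unfolding item_set.simps K_set_eq[OF km(1,2) ne_km] using T_eq km(3,4) by metis
        moreover have "stable_kernel x \<in> U_all \<alpha> a k m" if "x \<in> T" for x
          using uv(1)[OF that] collapse_kernel_in[of x k m] collapse_kernel_in[of x m k]
            U_all_commute[of k m] km(3,4) by auto
        then have "admissible \<alpha> a (Item_K {k, m} (stable_kernel ` T))"
          using km ne_km l ne unfolding admissible.simps by (intro conjI exI[of _ k] exI[of _ m]) auto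
        ultimately show ?thesis by blast
      next
        fix u
        let ?M = "{v. \<exists>x\<in>T. collapse x u v}"
        assume u: "u \<in> A" "\<And>x. x \<in> T \<Longrightarrow> \<exists>v. collapse x u v" "1 < card ?M"
          and T_eq: "T = collapse_family ({u} \<times> ?M) UNIV (stable_range ` T)"
        obtain k where k: "k \<in> {1..l}" "u = a k" using ex_index[OF u(1)] by blast
        have "T = item_set \<alpha> a (Item_L k ?M (stable_range ` T))"
          unfolding item_set.simps L_set_eq[OF k(1)] using T_eq k(2) by metis
        moreover have "stable_range ` T \<subseteq> V_all \<alpha> a k"
          using collapse_range_in[OF _ k(1)] u(2) k(2) by blast
        moreover have "?M \<subseteq> a ` ({1..l} - {k})"
          unfolding A_minus_eq[OF k(1), symmetric] k(2) by (auto simp: collapse_def)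
        ultimately have "admissible \<alpha> a (Item_L k ?M (stable_range ` T))"
            "T = item_set \<alpha> a (Item_L k ?M (stable_range ` T))"
          using k(1) l ne u(3) by simp_all
        then show ?thesis by blast
      qed
    qed
  qed
qed

definition index :: "'n \<Rightarrow> nat" where "index = inv_into {1..l} a"

lemma index_a: "k \<in> {1..l} \<Longrightarrow> index (a k) = k"
  using bij_a unfolding index_def bij_betw_def by (metis inv_into_f_f)

text \<open>A left inverse of \<open>item_set\<close> on admissible items, which gives injectivity.
  The order of the tests relies on the side conditions: a pair set of type \<open>L\<close> has as
  many elements as \<open>M\<close>, hence more than one, and type \<open>K\<close> has two pairs
  with different first components.\<close>

definition item_of :: "('n \<Rightarrow> 'n) set \<Rightarrow> 'n item" where
  "item_of T =
    (if fulls T \<noteq> {} then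
       if \<exists>x\<in>T. stable_rank \<alpha> x < card A
       then Item_F_Low (stable_kernel ` fulls T) (stable_range ` fulls T)
       else Item_F (stable_kernel ` fulls T) (stable_range ` fulls T)
     else if \<exists>x\<in>T. stable_rank \<alpha> x \<noteq> card A - 1 then Item_Low
     else if card (pairs T) = 1 then
       Item_H (index (the_elem (fst ` pairs T))) (index (the_elem (snd ` pairs T)))
         (stable_kernel ` T) (stable_range ` T)
     else if card (fst ` pairs T) = 1 then
       Item_L (index (the_elem (fst ` pairs T))) (snd ` pairs T) (stable_range ` T)
     else Item_K (index ` fst ` pairs T) (stable_kernel ` T))"

lemma collapse_family_ranks:
  "fulls (collapse_family R X Y) = {}"
  "\<not> (\<exists>x\<in>collapse_family R X Y. stable_rank \<alpha> x \<noteq> card A - 1)"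
proof -
  have rank: "stable_rank \<alpha> x = card A - 1" "1 < card A" if "x \<in> collapse_family R X Y" for x
    using that collapse_stable_rank unfolding mem_collapse_family by blast+
  then show "\<not> (\<exists>x\<in>collapse_family R X Y. stable_rank \<alpha> x \<noteq> card A - 1)" by blast
  have "stable_rank \<alpha> x \<noteq> card A" if "x \<in> collapse_family R X Y" for x
    using rank[OF that] by linarith
  then show "fulls (collapse_family R X Y) = {}" unfolding fulls_def by blast
qed

lemma item_of_item_set:
  assumes p: "admissible \<alpha> a p"
  shows "item_of (item_set \<alpha> a p) = p"
proof (cases p)
  case (Item_F X Y)
  have XY: "X \<subseteq> X_all \<alpha> a" "Y \<subseteq> Y_all \<alpha> a" "X \<noteq> {}" "Y \<noteq> {}"
    using p Item_F by simp_all
  have fulls: "fulls (full_family X Y) = full_family X Y"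
    by (auto simp: fulls_def full_family_def)
  have low: "\<not> (\<exists>x\<in>full_family X Y. stable_rank \<alpha> x < card A)"
    by (auto simp: full_family_def)
  show ?thesis
    unfolding Item_F item_set.simps F_set_eq item_of_def fulls
    using low full_family_parameters[OF XY] by simp
next
  case (Item_H k m X Y)
  then have km: "k \<in> {1..l}" "m \<in> {1..l}" "k \<noteq> m"
    and XY: "X \<subseteq> U_all \<alpha> a k m" "Y \<subseteq> V_all \<alpha> a k" "X \<noteq> {}" "Y \<noteq> {}"
    using p by simp_all
  show ?thesis
    unfolding Item_H item_set.simps H_set_eq[OF km(1)] item_of_def
    by (simp only: collapse_family_ranks singleton_family_parameters[OF km XY] not_False_eq_True
        if_False if_True HOL.simp_thms)
      (simp add: index_a[OF km(1)] index_a[OF km(2)])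
next
  case (Item_K q X)
  then obtain k m where km: "k \<in> {1..l}" "m \<in> {1..l}" "k \<noteq> m" and q: "q = {k, m}"
    and X: "X \<subseteq> U_all \<alpha> a k m" "X \<noteq> {}"
    using p by auto
  have "a k \<noteq> a m" using a_eq_iff km by blast
  then show ?thesis
    unfolding Item_K item_set.simps q K_set_eq[OF km] item_of_def
    by (simp only: collapse_family_ranks swap_family_parameters[OF km X] not_False_eq_True
        if_False if_True HOL.simp_thms)
      (simp add: index_a[OF km(1)] index_a[OF km(2)])
next
  case (Item_L k M Y)
  then have k: "k \<in> {1..l}" and M: "M \<subseteq> A - {a k}" "M \<noteq> {}" "card M \<noteq> 1"
    and Y: "Y \<subseteq> V_all \<alpha> a k" "Y \<noteq> {}"
    using p A_minus_eq[of k] by auto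
  have proj: "fst ` ({a k} \<times> M) = {a k}" "snd ` ({a k} \<times> M) = M" "card ({a k} \<times> M) \<noteq> 1"
    using M by (simp_all add: card_cartesian_product)
  show ?thesis
    unfolding Item_L item_set.simps L_set_eq[OF k] item_of_def
    by (simp only: collapse_family_ranks times_family_parameters[OF k M(1,2) Y] proj not_False_eq_True
        if_False if_True HOL.simp_thms)
      (simp add: index_a[OF k])
next
  case Item_Low
  then have card: "2 < card A" using p by (simp add: card_A)
  have "fulls {x. stable_rank \<alpha> x < card A} = {}" by (auto simp: fulls_def)
  moreover have "\<exists>x\<in>{x. stable_rank \<alpha> x < card A}. stable_rank \<alpha> x \<noteq> card A - 1"
    \<comment> \<open>Constants have stable rank 1, which differs from \<open>card A - 1\<close>
      exactly because \<open>2 < card A\<close>; this separates the item from all collapse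
      families.\<close>
    using const_low[of undefined] card by (intro bexI[of _ "\<lambda>_. undefined"]) auto
  ultimately show ?thesis
    unfolding Item_Low item_set.simps Low_eq item_of_def by simp
next
  case (Item_F_Low X Y)
  have card: "1 < card A" using p Item_F_Low by (simp add: card_A)
  have XY: "X \<subseteq> X_all \<alpha> a" "Y \<subseteq> Y_all \<alpha> a" "X \<noteq> {}" "Y \<noteq> {}"
    using p Item_F_Low by simp_all
  let ?T = "full_family X Y \<union> {x. stable_rank \<alpha> x < card A}"
  have fulls: "fulls ?T = full_family X Y"
    by (auto simp: fulls_def full_family_def)
  have low: "\<exists>x\<in>?T. stable_rank \<alpha> x < card A"
    using const_low[OF card, of undefined] card by (intro bexI[of _ "\<lambda>_. undefined"]) auto
  show ?thesis
    unfolding Item_F_Low item_set.simps F_set_eq Low_eq item_of_def fulls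
    using low full_family_parameters[OF XY] by simp
qed

end

theorem theorem27:
  fixes \<alpha> :: "'n::finite \<Rightarrow> 'n" and a :: "nat \<Rightarrow> 'n" and l :: nat
  assumes idempotent: "\<alpha> \<circ> \<alpha> = \<alpha>"
    and rank: "map_rank \<alpha> = l"
    and image: "bij_betw a {1..l} (range \<alpha>)"
  shows "(\<forall>T. isolated_subsemigroup (variant \<alpha>) T \<longleftrightarrow>
            (\<exists>p. admissible \<alpha> a p \<and> T = item_set \<alpha> a p)) \<and>
         (\<forall>p q. admissible \<alpha> a p \<and> admissible \<alpha> a q \<and> p \<noteq> q \<longrightarrow>
            item_set \<alpha> a p \<noteq> item_set \<alpha> a q)"
proof -
  interpret enumerated_variant \<alpha> a
    using idempotent image rank by unfold_locales simp_all
  show ?thesis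
    using isolated_admissible admissible_isolated item_of_item_set by metis
qed

end
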